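(* Let $n\ge 2$, $d\ge 1$, and $p\in\mathcal H(n,d)$. Then $$ d\le\frac{2n\,(2N(p)-3)}{3n^2-3n-2}\le\frac{4}{3}\cdot\frac{2N(p)-3}{2n-3}. $$
   Context: $\mathcal H(n,d)$ is the set of real polynomials in $x_1,\dots,x_n$ of total degree exactly $d$, with all coefficients nonnegative, such that $p(x)=1$ whenever $\sum_{j=1}^n x_j=1$. $N(p)$ denotes the number of distinct monomials occurring with nonzero coefficient in $p$. *)

theory Defs
  imports Complex_Main
begin

text \<open>A real polynomial in the variables x_0,...,x_(n-1) is represented by its
coefficient function c, mapping exponent vectors (alpha :: nat => nat) to reals,
with finite support, and every monomial in the support only involving the
first n variables.\<close>

definition mon_support :: "((nat \<Rightarrow> nat) \<Rightarrow> real) \<Rightarrow> (nat \<Rightarrow> nat) set" where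
  "mon_support c = {\<alpha>. c \<alpha> \<noteq> 0}"

definition is_poly :: "nat \<Rightarrow> ((nat \<Rightarrow> nat) \<Rightarrow> real) \<Rightarrow> bool" where
  "is_poly n c \<longleftrightarrow> finite (mon_support c) \<and> (\<forall>\<alpha>\<in>mon_support c. \<forall>i\<ge>n. \<alpha> i = 0)"

definition tdeg :: "nat \<Rightarrow> (nat \<Rightarrow> nat) \<Rightarrow> nat" where
  "tdeg n \<alpha> = (\<Sum>i<n. \<alpha> i)"

definition peval :: "nat \<Rightarrow> ((nat \<Rightarrow> nat) \<Rightarrow> real) \<Rightarrow> (nat \<Rightarrow> real) \<Rightarrow> real" where
  "peval n c x = (\<Sum>\<alpha>\<in>mon_support c. c \<alpha> * (\<Prod>i<n. x i ^ \<alpha> i))"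

definition has_degree :: "nat \<Rightarrow> ((nat \<Rightarrow> nat) \<Rightarrow> real) \<Rightarrow> nat \<Rightarrow> bool" where
  "has_degree n c d \<longleftrightarrow> mon_support c \<noteq> {} \<and> Max (tdeg n ` mon_support c) = d"

definition Nmon :: "((nat \<Rightarrow> nat) \<Rightarrow> real) \<Rightarrow> nat" where
  "Nmon c = card (mon_support c)"

definition H_class :: "nat \<Rightarrow> nat \<Rightarrow> ((nat \<Rightarrow> nat) \<Rightarrow> real) set" where
  "H_class n d = {c. is_poly n c \<and> has_degree n c d \<and> (\<forall>\<alpha>. c \<alpha> \<ge> 0) \<and>
     (\<forall>x::nat \<Rightarrow> real. (\<Sum>j<n. x j) = 1 \<longrightarrow> peval n c x = 1)}"

end

theory Submission
  imports Defs "HOL-Computational_Algebra.Polynomial"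
begin

text \<open>Write 1 - p = (1 - s) q with s the sum of the variables, so that every coefficient of p
  is a signed sum of neighbouring coefficients of q. Everything follows from Descartes' rule of
  signs: multiplication by 1 - z creates a sign change, and adding one term removes at most two.

  For n = 2 this is applied, from the top degree downwards, to the homogeneous parts
  p_k = (x + y) q_(k-1) - q_k with alternating signs.

  For n \<ge> 3 fix a variable z and let M be the largest degree of p in the other n - 1
  variables. The claim is N(p) \<ge> (n - 1) M + 1. The top degree part of p is divisible by s,
  hence contains two monomials, and a suitable z gives n M \<ge> (n - 1) d + 1, which is enough.
  Sort the monomials into rows by their degree t in the variables other than z, and let \<sigma> be
  the sum of these variables; the rows satisfy p_t = \<sigma> q_(t-1) - (1 - z) q_t.

  If n \<ge> 4 and the J - 1 rows before row t are empty, then at z = 1 row t is a nonzero form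
  with nonnegative coefficients divisible by \<sigma>^J; the edges of its Newton polytope carry at
  least (n - 1) J monomials.

  If n = 3, let C_t be the number of terms in rows 0, ..., t and v_t the \<sigma>-adic valuation of
  q_t. One shows C_t + v_t \<ge> 2 t + 1 for t < M; since \<sigma>^(v+1) divides the last row, where
  v = v_(M-1), that row has at least v + 2 terms. Let j < t be the last index with
  v_j - j > v_t - t. Linear functionals on the forms of row j + 1 that annihilate multiples of
  \<sigma>^(v_j + 1) and kill v_j monomials of that row turn q_(j+1) into a polynomial in z with few
  sign changes. Lifting such functionals from one row to the next, the free parameter of the lift
  can be chosen such that T new terms cost at most T - 1 sign changes. Finally some functional does
  not kill q_t, and counting gives the inequality for t from the one for j.\<close>

section \<open>Sign changes\<close>

definition sign_changes :: "(nat \<Rightarrow> bool) \<Rightarrow> nat set" where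
  "sign_changes e = {c. e c \<noteq> e (Suc c)}"

definition compat :: "(nat \<Rightarrow> bool) \<Rightarrow> (nat \<Rightarrow> real) \<Rightarrow> bool" where
  "compat e f \<longleftrightarrow> (\<forall>c. (e c \<longrightarrow> 0 \<le> f c) \<and> (\<not> e c \<longrightarrow> f c \<le> 0))"

text \<open>Zeros are ignored, so at most k sign changes means that some sign pattern with at most k
  changes fits.\<close>
definition var_le :: "(nat \<Rightarrow> real) \<Rightarrow> nat \<Rightarrow> bool" where
  "var_le f k \<longleftrightarrow> (\<exists>e. compat e f \<and> finite (sign_changes e) \<and> card (sign_changes e) \<le> k)"

lemma var_le_mono: "var_le f k \<Longrightarrow> k \<le> l \<Longrightarrow> var_le f l"
  unfolding var_le_def using order_trans by blast

lemma var_le_zero: "var_le (\<lambda>_. 0) 0"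
  unfolding var_le_def compat_def sign_changes_def by (intro exI[of _ "\<lambda>_. True"]) simp

text \<open>A new sign at one position affects only the pairs with its two neighbours, hence the
  factor 2. This is the price of adding terms whose size is not controlled.\<close>

lemma var_le_flip:
  assumes e: "finite (sign_changes e)" "card (sign_changes e) \<le> k" and B: "finite B"
    and h: "\<And>c. c \<notin> B \<Longrightarrow> (e c \<longrightarrow> 0 \<le> h c) \<and> (\<not> e c \<longrightarrow> h c \<le> 0)"
  shows "var_le h (k + 2 * card B)"
proof -
  define e' where "e' c = (if c \<in> B then 0 \<le> h c else e c)" for c
  have sub: "sign_changes e' \<subseteq> sign_changes e \<union> B \<union> (\<lambda>c. c - 1) ` B"
  proof
    fix c assume c: "c \<in> sign_changes e'"
    show "c \<in> sign_changes e \<union> B \<union> (\<lambda>c. c - 1) ` B"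
    proof (cases "c \<in> B \<or> Suc c \<in> B")
      case True
      then show ?thesis by (metis UnCI diff_Suc_1 image_eqI)
    next
      case False
      then show ?thesis using c unfolding sign_changes_def e'_def by auto
    qed
  qed
  have fin: "finite (sign_changes e')"
    using sub e(1) B by (meson finite_UnI finite_imageI finite_subset)
  have "card (sign_changes e') \<le> card (sign_changes e \<union> B \<union> (\<lambda>c. c - 1) ` B)"
    using sub e(1) B by (intro card_mono) auto
  also have "\<dots> \<le> card (sign_changes e) + card B + card ((\<lambda>c. c - 1) ` B)"
    by (meson add_le_mono card_Un_le order_refl order_trans)
  also have "\<dots> \<le> k + card B + card B"
    using e(2) card_image_le[OF B, of "\<lambda>c. c - 1"] by linarith
  finally have "card (sign_changes e') \<le> k + 2 * card B" by simp
  moreover have "compat e' h" unfolding compat_def e'_def using h by auto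
  ultimately show ?thesis unfolding var_le_def using fin by blast
qed

lemma var_le_card:
  assumes "finite {c. y c \<noteq> 0}" "card {c. y c \<noteq> 0} \<le> Suc k"
  shows "var_le y k"
  using assms
proof (induction k arbitrary: y)
  case 0
  then consider "{c. y c \<noteq> 0} = {}" | a where "{c. y c \<noteq> 0} = {a}"
    by (metis One_nat_def card_0_eq card_1_singletonE le_Suc_eq le_zero_eq)
  then show ?case
  proof cases
    case 1 
    then have "y = (\<lambda>_. 0)" by (intro ext) blast
    then show ?thesis using var_le_zero by simp
  next
    case 2
    then have "y c = 0" if "c \<noteq> a" for c using that by blast
    then have "compat (\<lambda>_. 0 \<le> y a) y" unfolding compat_def
      by (metis linorder_le_cases order_refl)
    then show ?thesis unfolding var_le_def by (intro exI[of _ "\<lambda>_. 0 \<le> y a"]) (simp add: sign_changes_def)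
  qed
next
  case (Suc k)
  show ?case
  proof (cases "{c. y c \<noteq> 0} = {}")
    case True
    then have "y = (\<lambda>_. 0)" by (intro ext) blast
    then show ?thesis using var_le_mono[OF var_le_zero] by simp
  next
    case False
    define n where "n = Max {c. y c \<noteq> 0}"
    have n: "y n \<noteq> 0" using Max_in[OF Suc.prems(1) False] unfolding n_def by simp
    have gt: "y c = 0" if "c > n" for c
      using Max_ge[OF Suc.prems(1), of c] that unfolding n_def by force
    define y' where "y' = y(n := 0)"
    have eq: "{c. y' c \<noteq> 0} = {c. y c \<noteq> 0} - {n}" unfolding y'_def by auto
    have "card {c. y' c \<noteq> 0} \<le> Suc k" using eq Suc.prems n by (simp add: card_Diff_singleton_if)
    then have "var_le y' k" using Suc.IH[of y'] eq Suc.prems(1) by simp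
    then obtain e where e: "compat e y'" "finite (sign_changes e)" "card (sign_changes e) \<le> k"
      unfolding var_le_def by blast
    \<comment> \<open>From the last nonzero entry on, the pattern is frozen, so the only possible
      new change is at \<open>n - 1\<close>.\<close>
    define e' where "e' c = (if c < n then e c else 0 \<le> y n)" for c
    have "compat e' y" using e(1) gt unfolding compat_def e'_def y'_def
      by (smt (verit) fun_upd_apply linorder_neqE_nat)
    moreover have sub: "sign_changes e' \<subseteq> insert (n - 1) (sign_changes e)"
      unfolding sign_changes_def e'_def by (auto split: if_splits)
    moreover have "finite (sign_changes e')" using sub e(2) by (meson finite.insertI finite_subset)
    moreover have "card (insert (n - 1) (sign_changes e)) \<le> Suc k"
      using e(2,3) by (simp add: card_insert_if)
    then have "card (sign_changes e') \<le> Suc k"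
      using card_mono[OF _ sub] e(2) by fastforce
    ultimately show ?thesis unfolding var_le_def by blast
  qed
qed

text \<open>H is monotone on each block where e is constant, so it changes sign at most once there, and
  not at all on the first and the last block.\<close>
lemma var_le_div:
  fixes H h :: "nat \<Rightarrow> real"
  assumes h: "\<And>c. h c = H c - (if c = 0 then 0 else H (c - 1))"
    and fin: "\<And>c. c \<ge> K \<Longrightarrow> H c = 0" and nz: "H c0 \<noteq> 0" and v: "var_le h k"
  shows "\<exists>k'. k = Suc k' \<and> var_le H k'"
proof -
  obtain e where e: "compat e h" "finite (sign_changes e)" "card (sign_changes e) \<le> k"
    using v unfolding var_le_def by blast
  have const: "e a = e b" if "a \<le> b" "\<And>c. a \<le> c \<Longrightarrow> c < b \<Longrightarrow> c \<notin> sign_changes e" for a b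
    using that
  proof (induction b)
    case (Suc b)
    show ?case
    proof (cases "a = Suc b")
      case False
      then have "e a = e b" using Suc by auto
      moreover have "e b = e (Suc b)" using Suc.prems(1) Suc.prems(2)[of b] False
        unfolding sign_changes_def by auto
      ultimately show ?thesis by simp
    qed simp
  qed simp
  have up: "H a \<le> H b" if "a \<le> b" "\<And>c. a < c \<Longrightarrow> c \<le> b \<Longrightarrow> e c" for a b
    using that
  proof (induction b)
    case (Suc b)
    then show ?case
    proof (cases "a = Suc b")
      case False
      then have "H a \<le> H b" using Suc by auto
      moreover have "0 \<le> h (Suc b)" using e(1) Suc.prems False unfolding compat_def by auto
      ultimately show ?thesis using h[of "Suc b"] by simp
    qed simp
  qed simp
  have dn: "H b \<le> H a" if "a \<le> b" "\<And>c. a < c \<Longrightarrow> c \<le> b \<Longrightarrow> \<not> e c" for a b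
    using that
  proof (induction b)
    case (Suc b)
    then show ?case
    proof (cases "a = Suc b")
      case False
      then have "H b \<le> H a" using Suc by auto
      moreover have "h (Suc b) \<le> 0" using e(1) Suc.prems False unfolding compat_def by auto
      ultimately show ?thesis using h[of "Suc b"] by simp
    qed simp
  qed simp
  have h0: "H 0 = h 0" using h[of 0] by simp
  \<comment> \<open>Without a change \<open>H\<close> would move monotonically away from 0 and could
    not be 0 again at \<open>b\<close>.\<close>
  have "sign_changes e \<noteq> {}"
  proof
    assume emp: "sign_changes e = {}"
    have all: "e c = e 0" for c using const[of 0 c] emp by simp
    define b where "b = max K c0"
    have b: "c0 \<le> b" "H b = 0" using fin unfolding b_def by auto
    show False
    proof (cases "e 0")
      case True
      have "0 \<le> H 0" using h0 e(1) True unfolding compat_def by auto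
      then show False using up[of 0 c0] up[of c0 b] all True b nz by auto
    next
      case False
      have "H 0 \<le> 0" using h0 e(1) False unfolding compat_def by auto
      then show False using dn[of 0 c0] dn[of c0 b] all False b nz by auto
    qed
  qed
  define N where "N = Max (sign_changes e)"
  have N: "N \<in> sign_changes e" using Max_in e(2) \<open>sign_changes e \<noteq> {}\<close> unfolding N_def by blast
  have last: "e c = e (Suc N)" if "c > N" for c
  proof -
    have "a \<notin> sign_changes e" if "Suc N \<le> a" for a
      using Max_ge[OF e(2), of a] that unfolding N_def by auto
    then show ?thesis using const[of "Suc N" c] that by auto
  qed
  \<comment> \<open>After the last change of \<open>e\<close>, \<open>H\<close> runs monotonically
    to its final value 0, so its sign is opposite to that of \<open>h\<close>. Before, zeros of
    \<open>H\<close> take the sign of \<open>h\<close>, so that every change of \<open>e'\<close>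
    goes towards the sign of the current block.\<close>
  define e' where "e' c = (if c > N then \<not> e (Suc N) else if H c = 0 then e c else 0 < H c)" for c
  have lastH: "(e (Suc N) \<longrightarrow> H c \<le> 0) \<and> (\<not> e (Suc N) \<longrightarrow> 0 \<le> H c)" if "c \<ge> N" for c
  proof -
    define b where "b = max K c"
    have b: "c \<le> b" "H b = 0" using fin unfolding b_def by auto
    show ?thesis using up[of c b] dn[of c b] b last that by fastforce
  qed
  have comp: "compat e' H" unfolding compat_def e'_def using lastH by (auto simp: not_less)
  \<comment> \<open>Once \<open>H\<close> has the sign of its increments, it keeps this sign until
    the block ends.\<close>
  have step: "e' (Suc c) = e (Suc c)" if c: "e' c = e (Suc c)" "Suc c \<le> N" for c
  proof -
    have cN: "\<not> c > N" "\<not> Suc c > N" using c(2) by auto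
    show ?thesis
    proof (cases "e (Suc c)")
      case True
      then have "e' c" using c by simp
      then have "0 \<le> H c" unfolding e'_def using cN by (auto split: if_splits)
      moreover have "0 \<le> h (Suc c)" using e(1) True unfolding compat_def by auto
      ultimately have "0 \<le> H (Suc c)" using h[of "Suc c"] by simp
      then show ?thesis using True cN unfolding e'_def by auto
    next
      case False
      then have "\<not> e' c" using c by simp
      then have "H c \<le> 0" unfolding e'_def using cN by (auto split: if_splits)
      moreover have "h (Suc c) \<le> 0" using e(1) False unfolding compat_def by auto
      ultimately have "H (Suc c) \<le> 0" using h[of "Suc c"] by simp
      then show ?thesis using False cN unfolding e'_def by auto
    qed
  qed
  have chN: "c < N \<and> e' c = (\<not> e (Suc c)) \<and> e' (Suc c) = e (Suc c)" if "c \<in> sign_changes e'" for c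
  proof -
    have ne: "e' c \<noteq> e' (Suc c)" using that unfolding sign_changes_def by simp
    have "c < N"
    proof (rule ccontr)
      assume "\<not> c < N"
      then consider "c > N" | "c = N" by linarith
      then show False
      proof cases
        case 1 then show False using ne unfolding e'_def by auto
      next
        case 2
        have eN: "e N = (\<not> e (Suc N))" using N unfolding sign_changes_def by auto
        have "e' N = (\<not> e (Suc N))"
          unfolding e'_def using eN lastH[of N] by auto
        moreover have "e' (Suc N) = (\<not> e (Suc N))" unfolding e'_def by simp
        ultimately show False using ne 2 by simp
      qed
    qed
    moreover have "e' c = (\<not> e (Suc c))"
      using step[of c] ne calculation by (metis Suc_leI)
    ultimately show ?thesis using ne by auto
  qed
  have run: "e' b = e b" if "a \<le> b" "b \<le> N" "e' a = e a" "\<And>c. a \<le> c \<Longrightarrow> c < b \<Longrightarrow> c \<notin> sign_changes e" for a b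
    using that
  proof (induction b)
    case (Suc b)
    show ?case
    proof (cases "a = Suc b")
      case False
      then have "e' b = e b" using Suc by auto
      moreover have "e b = e (Suc b)" using Suc.prems(1,4) False unfolding sign_changes_def by auto
      ultimately show ?thesis using step[of b] Suc.prems(2) by simp
    qed (use Suc in auto)
  qed simp
  \<comment> \<open>The first block contains no change of \<open>e'\<close>, because
    \<open>H 0 = h 0\<close>.\<close>
  have e0: "e' 0 = e 0" if "0 < N" 
  proof -
    have "(e 0 \<longrightarrow> 0 \<le> H 0) \<and> (\<not> e 0 \<longrightarrow> H 0 \<le> 0)" using h0 e(1) unfolding compat_def by auto
    then show ?thesis unfolding e'_def using that by auto
  qed
  \<comment> \<open>\<open>start c\<close> is the change of \<open>e\<close> that opens the block in
    which \<open>e'\<close> changes between \<open>c\<close> and \<open>c + 1\<close>. It is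
    injective and misses \<open>N\<close>, so \<open>e'\<close> has fewer changes than
    \<open>e\<close>.\<close>
  define start where "start c = Max {a \<in> sign_changes e. a \<le> c}" for c
  have ex: "{a \<in> sign_changes e. a \<le> c} \<noteq> {}" if "c \<in> sign_changes e'" for c
  proof
    assume emp: "{a \<in> sign_changes e. a \<le> c} = {}"
    have cN: "c < N" "e' c = (\<not> e (Suc c))" using chN[OF that] by auto
    have "e' 0 = e 0" using e0 cN(1) by simp
    moreover have "a \<notin> sign_changes e" if "a < c" for a using emp that by auto
    ultimately have "e' c = e c" using run[of 0 c] cN(1) by auto
    moreover have "c \<notin> sign_changes e" using emp by auto
    ultimately show False using cN unfolding sign_changes_def by auto
  qed
  have st: "start c \<in> sign_changes e" "start c \<le> c" "\<And>a. a \<in> sign_changes e \<Longrightarrow> a \<le> c \<Longrightarrow> a \<le> start c"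
    if "c \<in> sign_changes e'" for c
  proof -
    have "finite {a \<in> sign_changes e. a \<le> c}" using e(2) by simp
    from Max_in[OF this ex[OF that]] Max_ge[OF this]
    show "start c \<in> sign_changes e" "start c \<le> c" "\<And>a. a \<in> sign_changes e \<Longrightarrow> a \<le> c \<Longrightarrow> a \<le> start c"
      unfolding start_def by auto
  qed
  have inj: "inj_on start (sign_changes e')"
  proof (rule linorder_inj_onI')
    fix a b assume ab: "a \<in> sign_changes e'" "b \<in> sign_changes e'" "a < b"
    show "start a \<noteq> start b"
    proof
      assume eq: "start a = start b"
      have none: "c \<notin> sign_changes e" if "Suc a \<le> c" "c \<le> b" for c
        using st(3)[OF ab(2), of c] st(2)[OF ab(1)] eq that by auto
      have "e' b = e b"
        using run[of "Suc a" b] chN[OF ab(1)] chN[OF ab(2)] ab(3) none by auto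
      moreover have "e b = e (Suc b)" using none[of b] ab(3) unfolding sign_changes_def by auto
      ultimately show False using chN[OF ab(2)] by simp
    qed
  qed
  have img: "start ` sign_changes e' \<subseteq> sign_changes e - {N}"
  proof
    fix a assume "a \<in> start ` sign_changes e'"
    then obtain c where c: "c \<in> sign_changes e'" "a = start c" by blast
    then show "a \<in> sign_changes e - {N}" using st(1,2)[OF c(1)] chN[OF c(1)] by auto
  qed
  have fin': "finite (sign_changes e')"
    using inj img e(2) by (meson finite_Diff finite_imageD finite_subset)
  have "card (sign_changes e') \<le> card (sign_changes e - {N})"
    using card_inj_on_le[OF inj img] e(2) by simp
  also have "\<dots> = card (sign_changes e) - 1" using N e(2) by simp
  finally have "card (sign_changes e') \<le> k - 1" using e(3) by linarith
  moreover have "0 < card (sign_changes e)" using e(2) N by (auto simp: card_gt_0_iff)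
  ultimately show ?thesis unfolding var_le_def using comp fin' e(3) by (intro exI[of _ "k - 1"] conjI) auto
qed

section \<open>Polynomials divisible by powers of 1 + u\<close>

definition sg :: "real poly" where "sg = [:1, 1:]"

lemma sg_nonzero [simp]: "sg \<noteq> 0" by (simp add: sg_def)

lemma coeff_sg: "coeff (sg * f) i = coeff f i + (if i = 0 then 0 else coeff f (i - 1))"
  by (cases i) (auto simp: sg_def coeff_pCons)

definition ncoef :: "real poly \<Rightarrow> nat" where
  "ncoef f = card {i. coeff f i \<noteq> 0}"

lemma finite_coeffs: "finite {i. coeff (f :: real poly) i \<noteq> 0}"
  using MOST_coeff_eq_0[of f] by (simp add: MOST_iff_cofinite eventually_cofinite)

lemma ncoef_pos: "f \<noteq> 0 \<Longrightarrow> 1 \<le> ncoef f"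
  unfolding ncoef_def by (metis (mono_tags, lifting) One_nat_def Suc_leI card_gt_0_iff empty_iff finite_coeffs leading_coeff_0_iff mem_Collect_eq)

text \<open>The substitution of -u for u turns multiplication by 1 + u into a backward difference,
  the form treated by \<open>var_le_div\<close>.\<close>

definition alt :: "real poly \<Rightarrow> nat \<Rightarrow> real" where
  "alt f c = (- 1) ^ c * coeff f c"

lemma alt_eq_0_iff [simp]: "alt f c = 0 \<longleftrightarrow> coeff f c = 0"
  by (simp add: alt_def)

lemma alt_sg: "alt (sg * f) c = alt f c - (if c = 0 then 0 else alt f (c - 1))"
  by (cases c) (auto simp: alt_def algebra_simps coeff_sg)

lemma var_le_alt: "ncoef f \<le> Suc k \<Longrightarrow> var_le (alt f) k"
  using var_le_card[of "alt f" k] finite_coeffs[of f] by (simp add: ncoef_def)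

lemma var_le_alt_div:
  assumes "f \<noteq> 0" "var_le (alt (sg * f)) k"
  shows "\<exists>k'. k = Suc k' \<and> var_le (alt f) k'"
proof -
  have "alt f c = 0" if "c \<ge> Suc (degree f)" for c using that by (simp add: coeff_eq_0)
  moreover have "alt f (degree f) \<noteq> 0" using assms(1) by simp
  ultimately show ?thesis using var_le_div[of "alt (sg * f)" "alt f", OF alt_sg] assms(2) by blast
qed

text \<open>Descartes' rule: each factor \<open>sg\<close> accounts for one sign change of
  \<open>alt f\<close>, and m terms allow at most m - 1 changes.\<close>

lemma ncoef_sg_power:
  assumes "sg ^ A dvd f" "f \<noteq> 0"
  shows "Suc A \<le> ncoef f"
proof -
  have *: "A \<le> k" if "var_le (alt (sg ^ A * h)) k" "h \<noteq> 0" for h k A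
    using that
  proof (induction A arbitrary: k)
    case (Suc A)
    have "sg ^ A * h \<noteq> 0" using Suc.prems(2) by simp
    moreover have "var_le (alt (sg * (sg ^ A * h))) k" using Suc.prems(1) by (simp add: mult.assoc)
    ultimately obtain k' where "k = Suc k'" "var_le (alt (sg ^ A * h)) k'"
      using var_le_alt_div by blast
    then show ?case using Suc.IH[of k'] Suc.prems(2) by simp
  qed simp
  obtain h where h: "f = sg ^ A * h" using assms(1) by (elim dvdE)
  then have "h \<noteq> 0" using assms(2) by auto
  then have "A \<le> ncoef f - 1" using *[of A h "ncoef f - 1"] var_le_alt[of f "ncoef f - 1"] h by simp
  then show ?thesis using ncoef_pos[OF assms(2)] by simp
qed

lemma sg_dvd_iff: "sg dvd f \<longleftrightarrow> poly f (- 1) = 0"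
  using poly_eq_0_iff_dvd[of f "- 1"] by (simp add: sg_def)

lemma ncoef_add_var_le:
  assumes "var_le (alt g) k"
  shows "var_le (alt (p + g)) (k + 2 * ncoef p)"
proof -
  obtain e where e: "compat e (alt g)" "finite (sign_changes e)" "card (sign_changes e) \<le> k"
    using assms unfolding var_le_def by blast
  have "var_le (alt (p + g)) (k + 2 * card {i. coeff p i \<noteq> 0})"
  proof (rule var_le_flip[OF e(2,3) finite_coeffs])
    fix c assume "c \<notin> {i. coeff p i \<noteq> 0}"
    then show "(e c \<longrightarrow> 0 \<le> alt (p + g) c) \<and> (\<not> e c \<longrightarrow> alt (p + g) c \<le> 0)"
      using e(1) unfolding compat_def alt_def by simp
  qed
  then show ?thesis unfolding ncoef_def .
qed

text \<open>The sign changes of \<open>alt (g k)\<close> are bounded downwards from k = d - 1. In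
  \<open>sg * g k = p (Suc k) + g (Suc k)\<close> every term of \<open>p (Suc k)\<close> costs at
  most two changes, and the division by \<open>sg\<close> gains one. At k = 0 the number of changes
  must still be nonnegative.\<close>

lemma two_variable_bound:
  fixes p g :: "nat \<Rightarrow> real poly"
  assumes d: "d \<ge> 1" and rec: "\<And>k. p (Suc k) = sg * g k - g (Suc k)"
    and pos: "\<And>k i. 0 \<le> coeff (p k) i" and gd: "g d = 0" and pd: "p d \<noteq> 0"
  shows "d + 3 \<le> 2 * (\<Sum>k\<in>{1..d}. ncoef (p k))"
proof -
  have neg: "coeff (g (k + j)) i \<le> 0" if "\<And>i. coeff (g k) i \<le> 0" for k j i
  proof (induction j arbitrary: i)
    case (Suc j)
    have "coeff (sg * g (k + j)) i \<le> 0"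
      using Suc.IH by (auto simp: coeff_sg add_nonpos_nonpos)
    moreover have "g (k + Suc j) = sg * g (k + j) - p (k + Suc j)" using rec[of "k + j"] by simp
    ultimately show ?case using pos[of "k + Suc j" i] by simp
  qed (use that in simp)
  \<comment> \<open>If \<open>g k\<close> vanished, all later \<open>g\<close> would have
    nonpositive coefficients, since each step subtracts some \<open>p\<close>. Then
    \<open>p d = sg * g (d - 1)\<close> would be nonpositive as well, hence 0.\<close>
  have gnz: "g k \<noteq> 0" if "k < d" for k
  proof
    assume "g k = 0"
    then have "coeff (g (d - 1)) i \<le> 0" for i using neg[of k "d - 1 - k" i] that by simp
    moreover have pd': "p d = sg * g (d - 1)" using rec[of "d - 1"] d gd by simp
    ultimately have "coeff (p d) i \<le> 0" for i
      by (auto simp: coeff_sg add_nonpos_nonpos)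
    then have "p d = 0" using pos[of d] by (intro poly_eqI) (simp add: antisym)
    then show False using pd by simp
  qed
  have down: "\<exists>v. var_le (alt (g (d - 1 - j))) v \<and>
      v + j + 2 \<le> ncoef (p d) + 2 * (\<Sum>k\<in>{d - j..<d}. ncoef (p k))" if "j < d" for j
    using that
  proof (induction j)
    case 0
    have pd': "p d = sg * g (d - 1)" using rec[of "d - 1"] d gd by simp
    have "var_le (alt (sg * g (d - 1))) (ncoef (p d) - 1)"
      using var_le_alt[of "p d" "ncoef (p d) - 1"] pd' by simp
    then obtain v where "ncoef (p d) - 1 = Suc v" "var_le (alt (g (d - 1))) v"
      using var_le_alt_div[of "g (d - 1)"] gnz[of "d - 1"] d by fastforce
    then show ?case by (intro exI[of _ v]) simp
  next
    case (Suc j)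
    then obtain v where v: "var_le (alt (g (d - 1 - j))) v"
      "v + j + 2 \<le> ncoef (p d) + 2 * (\<Sum>k\<in>{d - j..<d}. ncoef (p k))" by auto
    define k where "k = d - 1 - Suc j"
    have k: "d - 1 - j = Suc k" "d - Suc j = Suc k" "d - j = Suc (Suc k)" "k < d" "Suc k < d"
      using Suc.prems unfolding k_def by auto
    have "sg * g k = p (Suc k) + g (Suc k)" using rec[of k] by simp
    then have "var_le (alt (sg * g k)) (v + 2 * ncoef (p (Suc k)))"
      using ncoef_add_var_le[of "g (Suc k)" v "p (Suc k)"] v(1) k by simp
    then obtain v' where v': "v + 2 * ncoef (p (Suc k)) = Suc v'" "var_le (alt (g k)) v'"
      using var_le_alt_div[OF gnz[OF k(4)]] by blast
    have "(\<Sum>i\<in>{Suc k..<d}. ncoef (p i)) = ncoef (p (Suc k)) + (\<Sum>i\<in>{Suc (Suc k)..<d}. ncoef (p i))"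
      using k(5) by (simp add: sum.atLeast_Suc_lessThan)
    then show ?case unfolding k(2) k_def[symmetric] using v v' k(3) by (intro exI[of _ v']) simp
  qed
  obtain v where v: "v + (d - 1) + 2 \<le> ncoef (p d) + 2 * (\<Sum>k\<in>{1..<d}. ncoef (p k))"
    using down[of "d - 1"] d by auto
  \<comment> \<open>So far the top part has weight 1. As a nonzero multiple of \<open>sg\<close> it
    has at least two terms; counting them again gives it weight 2 and improves d + 1 to d +
    3.\<close>
  have "sg dvd p d" using rec[of "d - 1"] d gd by simp
  then have "2 \<le> ncoef (p d)" using ncoef_sg_power[of 1 "p d"] pd by simp
  moreover have "{1..d} = insert d {1..<d}" using d by auto
  then have "(\<Sum>k\<in>{1..d}. ncoef (p k)) = ncoef (p d) + (\<Sum>k\<in>{1..<d}. ncoef (p k))" by simp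
  ultimately show ?thesis using v d by simp
qed

section \<open>Functionals on polynomials\<close>

definition lin :: "(real poly \<Rightarrow> real) \<Rightarrow> bool" where
  "lin l \<longleftrightarrow> (\<forall>f g. l (f + g) = l f + l g) \<and> (\<forall>a f. l (smult a f) = a * l f)"

lemma lin_add: "lin l \<Longrightarrow> l (f + g) = l f + l g" and lin_smult: "lin l \<Longrightarrow> l (smult a f) = a * l f"
  by (auto simp: lin_def)

lemma lin_0: "lin l \<Longrightarrow> l 0 = 0" using lin_smult[of l 0 0] by simp

lemma lin_diff: "lin l \<Longrightarrow> l (f - g) = l f - l g"
  using lin_add[of l f "smult (-1) g"] lin_smult[of l "-1" g] by simp

lemma lin_monoms:
  assumes "lin l" "l f \<noteq> 0"
  shows "\<exists>b. coeff f b \<noteq> 0 \<and> l (monom 1 b) \<noteq> 0"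
proof (rule ccontr)
  assume none: "\<not> ?thesis"
  have sm: "l (\<Sum>i\<in>I. h i) = (\<Sum>i\<in>I. l (h i))" if "finite I" for I :: "nat set" and h
    using that by (induction I) (simp_all add: lin_0[OF assms(1)] lin_add[OF assms(1)])
  have "l f = l (\<Sum>i\<le>degree f. smult (coeff f i) (monom 1 i))"
    by (subst poly_as_sum_of_monoms[symmetric, of f]) (simp add: smult_monom)
  also have "\<dots> = (\<Sum>i\<le>degree f. coeff f i * l (monom 1 i))"
    using sm lin_smult[OF assms(1)] by simp
  also have "\<dots> = 0" using none by (intro sum.neutral) auto
  finally show False using assms(2) by simp
qed

text \<open>The operator u d/du - b is diagonal on monomials with eigenvalue i - b at u^i. It kills
  u^b and lowers the order of vanishing at -1 by at most one.\<close>

definition euler :: "nat \<Rightarrow> real poly \<Rightarrow> real poly" where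
  "euler b f = [:0, 1:] * pderiv f - smult (of_nat b) f"

lemma euler_add: "euler b (f + g) = euler b f + euler b g"
  and euler_smult: "euler b (smult a f) = smult a (euler b f)"
  by (simp_all add: euler_def pderiv_add pderiv_smult algebra_simps smult_add_right smult_diff_right)

lemma euler_monom: "euler b (monom 1 i) = smult (of_nat i - of_nat b) (monom 1 i)"
proof (cases i)
  case 0 then show ?thesis by (simp add: euler_def pderiv_monom)
next
  case (Suc k)
  then show ?thesis unfolding euler_def
    by (intro poly_eqI) (auto simp: pderiv_monom coeff_pCons algebra_simps split: nat.split)
qed

text \<open>The cofactor is kept explicit: modulo \<open>sg\<close> it is a nonzero multiple of u f,
  so its divisibility by \<open>sg\<close> passes to \<open>f\<close>.\<close>

lemma euler_sg_power: "euler b (sg ^ Suc A * f) = sg ^ A * (smult (of_nat (Suc A)) ([:0, 1:] * f) + sg * euler b f)"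
proof -
  have "pderiv sg = 1" by (simp add: sg_def pderiv_pCons)
  then have "pderiv (sg ^ Suc A * f) = sg ^ Suc A * pderiv f + smult (of_nat (Suc A)) (sg ^ A * f)"
    by (simp only: pderiv_mult pderiv_power_Suc) (simp add: algebra_simps)
  then show ?thesis unfolding euler_def by (simp add: algebra_simps)
qed

text \<open>The functionals arise by composing Euler operators u d/du - b.\<close>
lemma killing_functionals_separate:
  assumes "finite E" "card E = Suc A"
    and "\<And>l. lin l \<Longrightarrow> (\<And>g. l (sg ^ Suc A * g) = 0) \<Longrightarrow>
      (\<exists>b0\<in>E. \<forall>b\<in>E - {b0}. l (monom 1 b) = 0) \<Longrightarrow> l f = 0"
  shows "sg ^ Suc A dvd f"
  using assms
proof (induction A arbitrary: E f)
  case 0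
  then obtain b where "E = {b}" by (metis One_nat_def card_1_singletonE)
  moreover have "lin (\<lambda>f. poly f (-1))" by (simp add: lin_def)
  moreover have "poly (sg ^ Suc 0 * g) (-1) = 0" for g by (simp add: sg_def)
  ultimately have "poly f (-1) = 0" using "0.prems"(3)[of "\<lambda>f. poly f (-1)"] by simp
  then show ?case by (simp add: sg_dvd_iff)
next
  case (Suc A)
  \<comment> \<open>A functional \<open>l\<close> admissible for \<open>E - {b}\<close> becomes
    admissible for \<open>E\<close> after composition with \<open>euler b\<close>, which kills u^b,
    rescales the other monomials and uses up one factor \<open>sg\<close>.\<close>
  have div: "sg ^ Suc A dvd euler b f" if b: "b \<in> E" for b
  proof (rule Suc.IH[of "E - {b}"])
    show "finite (E - {b})" "card (E - {b}) = Suc A" using Suc.prems b by auto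
    fix l assume l: "lin l" "\<And>g. l (sg ^ Suc A * g) = 0"
      "\<exists>b0\<in>E - {b}. \<forall>b'\<in>E - {b} - {b0}. l (monom 1 b') = 0"
    show "l (euler b f) = 0"
    proof (rule Suc.prems(3)[of "\<lambda>f. l (euler b f)"])
      show "lin (\<lambda>f. l (euler b f))" using l(1) by (simp add: lin_def euler_add euler_smult)
      show "l (euler b (sg ^ Suc (Suc A) * g)) = 0" for g using l(2) by (simp only: euler_sg_power)
      obtain b0 where b0: "b0 \<in> E - {b}" "\<And>b'. b' \<in> E - {b} - {b0} \<Longrightarrow> l (monom 1 b') = 0"
        using l(3) by blast
      have "l (euler b (monom 1 b')) = 0" if "b' \<in> E - {b0}" for b'
        unfolding euler_monom lin_smult[OF l(1)] using b0(2)[of b'] that by (cases "b' = b") auto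
      then show "\<exists>b0\<in>E. \<forall>b'\<in>E - {b0}. l (euler b (monom 1 b')) = 0" using b0(1) by blast
    qed
  qed
  obtain b b' where bb: "b \<in> E" "b' \<in> E" "b \<noteq> b'"
  proof -
    obtain b where b: "b \<in> E" using Suc.prems(2) by fastforce
    moreover have "card (E - {b}) = Suc A" using Suc.prems b by simp
    then obtain b' where "b' \<in> E - {b}" by (metis Zero_not_Suc card.empty ex_in_conv)
    ultimately show ?thesis using that[of b b'] by blast
  qed
  \<comment> \<open>Two Euler operators differ by a nonzero scalar, so \<open>f\<close> itself has
    \<open>A + 1\<close> factors \<open>sg\<close>. The last factor then comes from the cofactor in
    \<open>euler_sg_power\<close>, u being -1 at the root of \<open>sg\<close>.\<close>
  have "sg ^ Suc A dvd euler b f - euler b' f" using div bb by (intro dvd_diff)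
  moreover have "euler b f - euler b' f = smult (of_nat b' - of_nat b) f"
    by (simp add: euler_def algebra_simps smult_diff_left)
  ultimately have "sg ^ Suc A dvd f" using bb(3) by (simp add: dvd_smult_iff)
  then obtain h where h: "f = sg ^ Suc A * h" by (elim dvdE)
  have "sg ^ A * sg dvd sg ^ A * (smult (of_nat (Suc A)) ([:0, 1:] * h) + sg * euler b h)"
    using div[OF bb(1)] unfolding h euler_sg_power by (simp add: mult.commute)
  then have "sg dvd smult (of_nat (Suc A)) ([:0, 1:] * h) + sg * euler b h"
    by (subst (asm) dvd_times_left_cancel_iff) simp_all
  then have "sg dvd smult (of_nat (Suc A)) ([:0, 1:] * h)"
    by (metis dvd_add_times_triv_right_iff mult.commute)
  then have "sg dvd h" by (simp add: sg_dvd_iff)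
  then show ?case unfolding h by (metis mult.commute mult_dvd_mono dvd_refl power_Suc)
qed

text \<open>For linear \<open>l\<close> these are all linear functionals with value
  \<open>l f\<close> at \<open>sg * f\<close>: two of them differ by a multiple of evaluation at -1,
  and \<open>\<theta>\<close> is this free parameter.\<close>

definition lift :: "(real poly \<Rightarrow> real) \<Rightarrow> real \<Rightarrow> real poly \<Rightarrow> real" where
  "lift l \<theta> f = l (f div sg) + \<theta> * poly f (- 1)"

lemma lin_lift: "lin l \<Longrightarrow> lin (lift l \<theta>)"
  unfolding lin_def lift_def by (auto simp: poly_div_add_left div_smult_left algebra_simps)

lemma lift_sg: "lift l \<theta> (sg * f) = l f"
proof -
  have "sg * f div sg = f" by simp
  moreover have "poly (sg * f) (- 1) = 0" by (simp add: sg_def)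
  ultimately show ?thesis unfolding lift_def by simp
qed

section \<open>Rows in three variables\<close>

text \<open>The coefficient of z^c in (1 - z) H(z).\<close>

definition shift_diff :: "(nat \<Rightarrow> 'a :: ab_group_add) \<Rightarrow> nat \<Rightarrow> 'a" where
  "shift_diff H c = H c - (if c = 0 then 0 else H (c - 1))"

lemma sum_shift_diff: "(\<Sum>c\<le>K. shift_diff H c) = H K"
  by (induction K) (simp_all add: shift_diff_def)

lemma shift_diff_dvd:
  assumes "\<And>c. a dvd shift_diff H c"
  shows "a dvd (H c :: real poly)"
proof (induction c)
  case 0
  show ?case using assms[of 0] by (simp add: shift_diff_def)
next
  case (Suc c)
  then show ?case using dvd_add[OF assms[of "Suc c"] Suc.IH] by (simp add: shift_diff_def)
qed

lemma lin_shift_diff: "lin l \<Longrightarrow> l (shift_diff H c) = shift_diff (\<lambda>c. l (H c)) c"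
  by (simp add: shift_diff_def lin_diff lin_0)

text \<open>P t c and G t c are the coefficients of z^c in row t of p and q, dehomogenised by
  u = x / y; so sg = 1 + u plays the role of \<sigma>.\<close>
locale rows =
  fixes P G :: "nat \<Rightarrow> nat \<Rightarrow> real poly" and M K :: nat
  assumes M1: "M \<ge> 1"
    and Gfin: "\<And>t c. c \<ge> K \<Longrightarrow> G t c = 0"
    and Pfin: "\<And>t c. c > K \<Longrightarrow> P t c = 0"
    and pos: "\<And>t c i. 0 \<le> coeff (P t c) i"
    and P0: "\<And>c. P 0 c = (if c = 0 then 1 else 0) - shift_diff (G 0) c"
    and PS: "\<And>t c. P (Suc t) c = sg * G t c - shift_diff (G (Suc t)) c"
    and degG: "\<And>t c. degree (G t c) \<le> t"
    and GM: "\<And>c. G M c = 0"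
    and PM: "\<exists>c. P M c \<noteq> 0"
begin

section \<open>Terms of the rows of p and valuations of the rows of q\<close>

definition T :: "nat \<Rightarrow> nat" where "T t = (\<Sum>c\<le>K. ncoef (P t c))"

definition divides :: "nat \<Rightarrow> nat \<Rightarrow> bool" where
  "divides t e \<longleftrightarrow> (\<forall>c. sg ^ e dvd G t c)"

text \<open>The \<sigma>-adic valuation of row t of q. It is meaningful only if this row is nonzero,
  hence the hypothesis \<open>t < M\<close> in \<open>val_props\<close>.\<close>

definition val :: "nat \<Rightarrow> nat" where "val t = Max {e. divides t e}"

lemma sum_P0: "(\<Sum>c\<le>K. P 0 c) = 1"
proof -
  have "(\<Sum>c\<le>K. P 0 c) = (\<Sum>c\<le>K. if c = 0 then 1 else 0) - G 0 K"
    unfolding P0 sum_subtractf sum_shift_diff by simp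
  then show ?thesis using Gfin by simp
qed

text \<open>Summation over c sets z = 1, where the part with the factor 1 - z disappears.\<close>

lemma sum_PS: "(\<Sum>c\<le>K. P (Suc t) c) = sg * (\<Sum>c\<le>K. G t c)"
  unfolding PS sum_subtractf sum_shift_diff using Gfin by (simp add: sum_distrib_left)

text \<open>Nonnegative coefficients cannot cancel at z = 1.\<close>

lemma P_eq_0:
  assumes "(\<Sum>c\<le>K. P t c) = 0"
  shows "P t c = 0"
proof (cases "c \<le> K")
  case True
  have "coeff (P t c) i = 0" for i
  proof -
    have "(\<Sum>c\<le>K. coeff (P t c) i) = 0" using assms by (metis coeff_0 coeff_sum)
    then show ?thesis using True pos by (subst (asm) sum_nonneg_eq_0_iff) auto
  qed
  then show ?thesis by (intro poly_eqI) simp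
qed (use Pfin in auto)

text \<open>A zero row q_t makes p_(t+1) vanish at z = 1, hence identically. Then (1 - z) q_(t+1) =
  0, so the next row of q is zero too, and this continues until row M of p, which is
  nonzero.\<close>

lemma G_nonzero:
  assumes "t < M"
  shows "\<exists>c. G t c \<noteq> 0"
proof (rule ccontr)
  assume none: "\<not> ?thesis"
  have "(\<forall>c. G (t + j) c = 0) \<and> (\<forall>c. P (t + Suc j) c = 0)" for j
  proof (induction j)
    case 0
    have "(\<Sum>c\<le>K. P (Suc t) c) = 0" using sum_PS[of t] none by simp
    then have "P (Suc t) c = 0" for c by (rule P_eq_0)
    then show ?case using none by simp
  next
    case (Suc j)
    have "shift_diff (G (t + Suc j)) c = 0" for c
      using PS[of "t + j" c] conjunct1[OF Suc, rule_format, of c] conjunct2[OF Suc, rule_format, of c] by simp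
    \<comment> \<open>Divisibility by 0 means being 0, so \<open>shift_diff_dvd\<close> also cancels
      the factor 1 - z.\<close>
    then have "0 dvd G (t + Suc j) c" for c by (subst shift_diff_dvd[of 0 "G (t + Suc j)"]) simp_all
    then have G0: "G (t + Suc j) c = 0" for c by simp
    have "(\<Sum>c\<le>K. P (Suc (t + Suc j)) c) = 0" unfolding sum_PS G0 by simp
    then have "P (Suc (t + Suc j)) c = 0" for c by (rule P_eq_0)
    then show ?case using G0 by simp
  qed
  from this[of "M - Suc t"] have "\<forall>c. P (t + Suc (M - Suc t)) c = 0" by blast
  moreover have "t + Suc (M - Suc t) = M" using assms by simp
  ultimately show False using PM by metis
qed

lemma divides_le: "t < M \<Longrightarrow> divides t e \<Longrightarrow> e \<le> t"
proof -
  assume "t < M" "divides t e"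
  then obtain c where c: "G t c \<noteq> 0" "sg ^ e dvd G t c" using G_nonzero unfolding divides_def by blast
  then have "degree (sg ^ e) \<le> degree (G t c)" using dvd_imp_degree_le by blast
  moreover have "degree (sg ^ e) = e" by (simp add: degree_power_eq sg_def)
  ultimately show "e \<le> t" using degG[of t c] by simp
qed

lemma divides_0: "divides t 0" by (simp add: divides_def)

lemma val_props:
  assumes "t < M"
  shows "divides t (val t)" "\<And>e. divides t e \<Longrightarrow> e \<le> val t" "val t \<le> t"
proof -
  have fin: "finite {e. divides t e}"
    by (rule finite_subset[of _ "{..t}"]) (auto intro: divides_le[OF assms])
  have ne: "{e. divides t e} \<noteq> {}" using divides_0 by blast
  show d: "divides t (val t)" using Max_in[OF fin ne] unfolding val_def by simp
  show "\<And>e. divides t e \<Longrightarrow> e \<le> val t" using Max_ge[OF fin] unfolding val_def by simp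
  show "val t \<le> t" using divides_le[OF assms d] .
qed

text \<open>A budget of sign changes: the chain starts in row \<open>s\<close> with allowance
  \<open>T s - k0\<close>, and each later row m may add at most \<open>T m - 1\<close> changes. A
  row killed by \<open>l\<close> is exempt.\<close>

definition good :: "nat \<Rightarrow> nat \<Rightarrow> nat \<Rightarrow> (real poly \<Rightarrow> real) \<Rightarrow> bool" where
  "good s k0 i l \<longleftrightarrow> lin l \<and> ((\<exists>c. l (G i c) \<noteq> 0) \<longrightarrow>
     (\<exists>k. var_le (\<lambda>c. l (G i c)) k \<and> k + k0 + (i - s) \<le> (\<Sum>m\<in>{s..i}. T m)))"

text \<open>There are enough good functionals to detect every form not divisible by the given power
  of \<open>sg\<close>; the power grows by one with each row.\<close>

definition separated :: "nat \<Rightarrow> nat \<Rightarrow> nat \<Rightarrow> nat \<Rightarrow> bool" where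
  "separated a s k0 i \<longleftrightarrow> (\<forall>f. (\<forall>l. good s k0 i l \<longrightarrow> l f = 0) \<longrightarrow> sg ^ (a + (i - s)) dvd f)"

text \<open>For large \<open>\<theta>\<close> the sign of the new coefficient at a position touched by row
  \<open>i + 1\<close> is dictated by \<open>\<theta>\<close>, so one of the two signs of \<open>\<theta>\<close> disagrees with the old
  sign pattern in at most half of these positions.\<close>
lemma good_lift:
  assumes g: "good s k0 i l" and si: "s \<le> i" and bound: "k0 + (i - s) \<le> (\<Sum>m\<in>{s..i}. T m)"
  shows "\<exists>r \<Theta>. r \<noteq> 0 \<and> (\<forall>\<theta>\<ge>\<Theta>. good s k0 (Suc i) (lift l (r * \<theta>)))"
proof -
  have l: "lin l" using g unfolding good_def by blast
  obtain k e where e: "compat e (\<lambda>c. l (G i c))" "finite (sign_changes e)" "card (sign_changes e) \<le> k"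
    and k: "k + k0 + (i - s) \<le> (\<Sum>m\<in>{s..i}. T m)"
  proof (cases "\<exists>c. l (G i c) \<noteq> 0")
    case True
    then obtain k where k: "var_le (\<lambda>c. l (G i c)) k" "k + k0 + (i - s) \<le> (\<Sum>m\<in>{s..i}. T m)"
      using g unfolding good_def by blast
    then obtain e where "compat e (\<lambda>c. l (G i c))" "finite (sign_changes e)" "card (sign_changes e) \<le> k"
      unfolding var_le_def by blast
    then show ?thesis using that k(2) by blast
  next
    case False
    \<comment> \<open>Goodness says nothing about the budget if \<open>l\<close> kills the row; here
      \<open>bound\<close> provides it with k = 0.\<close>
    then have "var_le (\<lambda>c. l (G i c)) 0" using var_le_zero by simp
    then obtain e where "compat e (\<lambda>c. l (G i c))" "finite (sign_changes e)" "card (sign_changes e) \<le> 0"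
      unfolding var_le_def by blast
    then show ?thesis using that[of e 0] bound by simp
  qed
  define q where "q c = poly (P (Suc i) c) (- 1)" for c
  \<comment> \<open>At positions in \<open>S1\<close> the parameter \<open>\<theta>\<close> acts. In
    \<open>S0\<close> it has no effect, but there the nonzero coefficient is a multiple of
    \<open>sg\<close> and has at least two terms, which pay for both sign changes.\<close>
  define S1 where "S1 = {c. c \<le> K \<and> q c \<noteq> 0}"
  define S0 where "S0 = {c. c \<le> K \<and> P (Suc i) c \<noteq> 0 \<and> q c = 0}"
  have fin: "finite S1" "finite S0" unfolding S1_def S0_def by auto
  \<comment> \<open>For large \<open>\<theta>\<close> the sign at a position of \<open>S1\<close> is
    that of \<open>- r * q c\<close>; \<open>D r\<close> collects the conflicts with
    \<open>e\<close>. The sets for r = 1 and r = -1 partition \<open>S1\<close>, so one of them has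
    at most half its size.\<close>
  define D where "D r = {c \<in> S1. e c = (0 < r * q c)}" for r :: real
  have "D 1 \<union> D (-1) = S1" "D 1 \<inter> D (-1) = {}" unfolding D_def S1_def by auto
  then have "card (D 1) + card (D (-1)) = card S1"
    using card_Un_disjoint[of "D 1" "D (-1)"] fin(1) unfolding D_def by simp
  then obtain r :: real where r: "r = 1 \<or> r = -1" "2 * card (D r) \<le> card S1"
  proof (cases "2 * card (D 1) \<le> card S1")
    case True then show ?thesis using that[of 1] by simp
  next
    case False
    then show ?thesis using that[of "-1"] \<open>card (D 1) + card (D (-1)) = card S1\<close> by simp
  qed
  have cards: "2 * card S0 + card S1 \<le> T (Suc i)"
  proof -
    have "2 * card S0 + card S1 = (\<Sum>c\<le>K. (if c \<in> S0 then 2 else 0) + (if c \<in> S1 then 1 else 0))"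
      unfolding sum.distrib by (simp add: sum.If_cases S0_def S1_def Int_def conj_commute)
    also have "\<dots> \<le> T (Suc i)" unfolding T_def
    proof (rule sum_mono)
      fix c
      have "2 \<le> ncoef (P (Suc i) c)" if "c \<in> S0"
        using ncoef_sg_power[of 1 "P (Suc i) c"] that unfolding S0_def q_def by (simp add: sg_dvd_iff)
      moreover have "1 \<le> ncoef (P (Suc i) c)" if "c \<in> S1"
      proof -
        have "P (Suc i) c \<noteq> 0" using that unfolding S1_def q_def by auto
        then show ?thesis by (rule ncoef_pos)
      qed
      moreover have "c \<notin> S0 \<or> c \<notin> S1" unfolding S0_def S1_def by auto
      ultimately show "(if c \<in> S0 then 2 else 0) + (if c \<in> S1 then 1 else 0) \<le> ncoef (P (Suc i) c)" by auto
    qed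
    finally show ?thesis .
  qed
  \<comment> \<open>From \<open>w c\<close> on, the \<open>\<theta>\<close> term dominates the rest
    at position c. Where \<open>q c = 0\<close>, division by zero gives \<open>w c = 0\<close>,
    which does not disturb the sum.\<close>
  define w where "w c = (\<bar>l (G i c)\<bar> + \<bar>l (P (Suc i) c div sg)\<bar>) / \<bar>q c\<bar>" for c
  define \<Theta> where "\<Theta> = (\<Sum>c\<le>K. w c)"
  have good: "good s k0 (Suc i) (lift l (r * \<theta>))" if th: "\<theta> \<ge> \<Theta>" for \<theta>
  proof -
    define l' where "l' = lift l (r * \<theta>)"
    have l': "lin l'" using lin_lift[OF l] unfolding l'_def .
    define H where "H c = l' (G (Suc i) c)" for c
    \<comment> \<open>This is \<open>l'\<close> applied to \<sigma> q_i - p_(i+1) = (1 - z) q_(i+1).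
      It has at most \<open>T (Suc i)\<close> more changes than the old row, and division by 1 - z
      removes one.\<close>
    define h where "h c = l (G i c) - l' (P (Suc i) c)" for c
    have hH: "h c = H c - (if c = 0 then 0 else H (c - 1))" for c
    proof -
      have "l' (P (Suc i) c) = l (G i c) - l' (shift_diff (G (Suc i)) c)"
        unfolding PS lin_diff[OF l'] by (simp add: l'_def lift_sg)
      then show ?thesis unfolding h_def lin_shift_diff[OF l'] H_def by (simp add: shift_diff_def)
    qed
    have "var_le h (k + 2 * card (S0 \<union> D r))"
    proof (rule var_le_flip[OF e(2,3)])
      show "finite (S0 \<union> D r)" using fin unfolding D_def by auto
      fix c assume c: "c \<notin> S0 \<union> D r"
      show "(e c \<longrightarrow> 0 \<le> h c) \<and> (\<not> e c \<longrightarrow> h c \<le> 0)"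
      proof (cases "P (Suc i) c = 0")
        case True
        then show ?thesis using e(1) lin_0[OF l'] unfolding h_def compat_def by simp
      next
        case False
        then have cK: "c \<le> K" using Pfin[of c "Suc i"] by (metis linorder_not_less)
        then have cS: "c \<in> S1" using c False unfolding S0_def S1_def by auto
        then have q: "q c \<noteq> 0" unfolding S1_def by auto
        have ec: "e c = (r * q c < 0)"
          using c cS r(1) q unfolding D_def by (auto simp: not_less le_less)
        have "w c \<le> \<Theta>" unfolding \<Theta>_def using cK member_le_sum[of c "{..K}" w]
          by (auto simp: w_def)
        then have "w c \<le> \<theta>" using th by simp
        then have "\<bar>l (G i c)\<bar> + \<bar>l (P (Suc i) c div sg)\<bar> \<le> \<theta> * \<bar>q c\<bar>"
          unfolding w_def using q by (simp add: divide_le_eq)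
        moreover have "h c = l (G i c) - l (P (Suc i) c div sg) - \<theta> * (r * q c)"
          unfolding h_def l'_def lift_def q_def by simp
        moreover have "\<theta> * \<bar>q c\<bar> = (if r * q c < 0 then - (\<theta> * (r * q c)) else \<theta> * (r * q c))"
          using r(1) by (auto simp: abs_if)
        ultimately show ?thesis unfolding ec by (auto split: if_splits)
      qed
    qed
    moreover have "2 * card (S0 \<union> D r) \<le> T (Suc i)"
      using card_Un_le[of S0 "D r"] r(2) cards by linarith
    ultimately have vh: "var_le h (k + T (Suc i))" using var_le_mono by simp
    have "\<exists>k'. var_le H k' \<and> k' + k0 + (Suc i - s) \<le> (\<Sum>m\<in>{s..Suc i}. T m)" if nz: "\<exists>c. H c \<noteq> 0"
    proof -
      obtain c0 where "H c0 \<noteq> 0" using nz by blast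
      moreover have "H c = 0" if "c \<ge> K" for c unfolding H_def using Gfin that lin_0[OF l'] by simp
      ultimately obtain k' where k': "k + T (Suc i) = Suc k'" "var_le H k'"
        using var_le_div[OF hH _ _ vh] by blast
      have "(\<Sum>m\<in>{s..Suc i}. T m) = (\<Sum>m\<in>{s..i}. T m) + T (Suc i)" using si by simp
      then show ?thesis using k k' si by (intro exI[of _ k']) auto
    qed
    then show ?thesis unfolding good_def H_def l'_def[symmetric] using l' by blast
  qed
  then show ?thesis using r(1) by (intro exI[of _ r] exI[of _ \<Theta>]) auto
qed

text \<open>A form of row i that is not divisible is missed by some good functional's kernel; this
  functional does not kill the row, so its budget inequality is in force.\<close>

lemma separated_bound:
  assumes "separated a s k0 i" "\<not> divides i (a + (i - s))"
  obtains l where "good s k0 i l" "k0 + (i - s) \<le> (\<Sum>m\<in>{s..i}. T m)"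
proof -
  obtain c where "\<not> sg ^ (a + (i - s)) dvd G i c" using assms(2) unfolding divides_def by blast
  then obtain l where l: "good s k0 i l" "l (G i c) \<noteq> 0"
    using assms(1) unfolding separated_def by blast
  then obtain k where "k + k0 + (i - s) \<le> (\<Sum>m\<in>{s..i}. T m)" unfolding good_def by blast
  then have "k0 + (i - s) \<le> (\<Sum>m\<in>{s..i}. T m)" by simp
  then show ?thesis using that l by blast
qed

text \<open>Varying the parameter of one lift detects the value at -1 and yields one factor
  \<open>sg\<close>. The cofactor is then tested by all good functionals of row i, through their
  lifts.\<close>

lemma separated_Suc:
  assumes sep: "separated a s k0 i" and nd: "\<not> divides i (a + (i - s))" and si: "s \<le> i"
  shows "separated a s k0 (Suc i)"
  unfolding separated_def
proof (intro allI impI)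
  fix f assume f: "\<forall>l. good s k0 (Suc i) l \<longrightarrow> l f = 0"
  obtain l0 where l0: "good s k0 i l0" and bound: "k0 + (i - s) \<le> (\<Sum>m\<in>{s..i}. T m)"
    using separated_bound[OF sep nd] .
  obtain r \<Theta> where r: "r \<noteq> 0" "\<And>\<theta>. \<theta> \<ge> \<Theta> \<Longrightarrow> good s k0 (Suc i) (lift l0 (r * \<theta>))"
    using good_lift[OF l0 si bound] by blast
  \<comment> \<open>Two admissible parameters: the difference of the two lifts is a nonzero multiple
    of evaluation at -1.\<close>
  have "lift l0 (r * \<Theta>) f = 0" "lift l0 (r * (\<Theta> + 1)) f = 0" using f r(2) by auto
  moreover have "lift l0 (r * (\<Theta> + 1)) f - lift l0 (r * \<Theta>) f = r * poly f (- 1)"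
    by (simp add: lift_def algebra_simps)
  ultimately have "r * poly f (- 1) = 0" by simp
  then have "sg dvd f" using r(1) by (simp add: sg_dvd_iff)
  then obtain f' where f': "f = sg * f'" by (elim dvdE)
  have "l f' = 0" if l: "good s k0 i l" for l
  proof -
    obtain r \<Theta> where "\<And>\<theta>. \<theta> \<ge> \<Theta> \<Longrightarrow> good s k0 (Suc i) (lift l (r * \<theta>))"
      using good_lift[OF l si bound] by blast
    then have "lift l (r * \<Theta>) f = 0" using f by auto
    then show ?thesis unfolding f' lift_sg .
  qed
  then have "sg ^ (a + (i - s)) dvd f'" using sep unfolding separated_def by blast
  then show "sg ^ (a + (Suc i - s)) dvd f" unfolding f' using si by (simp add: Suc_diff_le)
qed

text \<open>Separation is carried from row s to row t; non-divisibility in each row on the way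
  guarantees a good functional to lift, and in row t one that does not kill the row.\<close>

lemma chain_bound:
  assumes sep: "separated a s k0 s" and nd: "\<And>i. s \<le> i \<Longrightarrow> i \<le> t \<Longrightarrow> \<not> divides i (a + (i - s))"
    and st: "s \<le> t"
  shows "k0 + (t - s) \<le> (\<Sum>m\<in>{s..t}. T m)"
proof -
  have "separated a s k0 (s + j)" if "s + j \<le> t" for j
    using that
  proof (induction j)
    case (Suc j)
    then show ?case using separated_Suc[of a s k0 "s + j"] nd[of "s + j"] by simp
  qed (use sep in simp)
  from this[of "t - s"] have "separated a s k0 t" using st by simp
  then show ?thesis using separated_bound nd[of t] st by blast
qed

section \<open>The rows in which a chain of functionals can start\<close>

lemma T_card: "T t = card (SIGMA c:{..K}. {b. coeff (P t c) b \<noteq> 0})"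
  unfolding T_def ncoef_def using finite_coeffs by (subst card_SigmaI) auto

text \<open>With v = \<open>val j\<close>, a functional that annihilates multiples of
  \<open>sg ^ Suc v\<close> sees row j + 1 of p only as -(1 - z) q_(j+1). If it also kills v
  monomials of the row, at most \<open>T (Suc j) - v\<close> coefficients survive, so at most
  \<open>T (Suc j) - v - 1\<close> changes, and one fewer after dividing by 1 - z. Hence the
  constant v + 2.\<close>

lemma separated_start:
  assumes j: "Suc j < M" and nd: "\<not> divides (Suc j) (Suc (val j))"
  shows "separated (Suc (val j)) (Suc j) (Suc (Suc (val j))) (Suc j)"
proof -
  define v where "v = val j"
  define s where "s = Suc j"
  have "\<forall>c. \<exists>g. G j c = sg ^ v * g" using val_props(1)[of j] j
    unfolding v_def divides_def by (auto elim!: dvdE)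
  then obtain g where g: "\<And>c. G j c = sg ^ v * g c" by metis
  have P_eq: "P s c = sg ^ Suc v * g c - shift_diff (G s) c" for c
    unfolding s_def PS g by (simp add: mult.assoc)
  define F where "F = (\<Sum>c\<le>K. P s c)"
  have "sg ^ Suc v dvd F" unfolding F_def s_def sum_PS g
    by (simp add: sum_distrib_left[symmetric] mult.assoc)
  moreover have "F \<noteq> 0"
  proof
    assume "F = 0"
    then have "P s c = 0" for c unfolding F_def by (rule P_eq_0)
    then have "sg ^ Suc v dvd shift_diff (G s) c" for c using P_eq[of c]
      by (metis dvd_triv_left eq_iff_diff_eq_0)
    then have "sg ^ Suc v dvd G s c" for c by (rule shift_diff_dvd)
    then show False using nd unfolding divides_def v_def s_def by blast
  qed
  ultimately have "Suc (Suc v) \<le> card {b. coeff F b \<noteq> 0}"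
    using ncoef_sg_power unfolding ncoef_def by blast
  \<comment> \<open>Among the at least v + 2 exponents at z = 1, v + 1 are chosen; each functional
    will kill all but one of them.\<close>
  then obtain E where E: "E \<subseteq> {b. coeff F b \<noteq> 0}" "card E = Suc v" "finite E"
    by (metis (no_types, lifting) Suc_leD obtain_subset_with_card_n)
  have line: "\<exists>c\<le>K. coeff (P s c) b \<noteq> 0" if "b \<in> E" for b
    using E(1) that unfolding F_def coeff_sum by (auto dest: sum.not_neutral_contains_not_neutral)
  define Z where "Z = (SIGMA c:{..K}. {b. coeff (P s c) b \<noteq> 0})"
  have finZ: "finite Z" unfolding Z_def using finite_coeffs by (intro finite_SigmaI) auto
  have good: "good s (Suc (Suc v)) s l"
    if l: "lin l" "\<And>g. l (sg ^ Suc v * g) = 0" "\<exists>b0\<in>E. \<forall>b\<in>E - {b0}. l (monom 1 b) = 0" for l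
  proof -
    obtain b0 where b0: "b0 \<in> E" "\<And>b. b \<in> E - {b0} \<Longrightarrow> l (monom 1 b) = 0" using l(3) by blast
    define N where "N = {c. l (P s c) \<noteq> 0}"
    have "N \<subseteq> {..K}"
    proof
      fix c assume "c \<in> N"
      then have "P s c \<noteq> 0" unfolding N_def using lin_0[OF l(1)] by auto
      then show "c \<in> {..K}" using Pfin[of c s] by (metis atMost_iff linorder_not_less)
    qed
    then have finN: "finite N" by (rule finite_subset) simp
    \<comment> \<open>Each surviving position contains a monomial not in \<open>E - {b0}\<close>,
      and each of the v exponents in \<open>E - {b0}\<close> occurs in some other monomial of the
      row.\<close>
    have count: "card N + v \<le> T s"
    proof -
      define Z1 where "Z1 = {z \<in> Z. snd z \<notin> E - {b0}}"
      define Z2 where "Z2 = {z \<in> Z. snd z \<in> E - {b0}}"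
      have "N \<subseteq> fst ` Z1"
      proof
        fix c assume c: "c \<in> N"
        then obtain b where "coeff (P s c) b \<noteq> 0" "l (monom 1 b) \<noteq> 0"
          using lin_monoms[OF l(1)] unfolding N_def by blast
        then have "(c, b) \<in> Z1" unfolding Z1_def Z_def using b0(2) c \<open>N \<subseteq> {..K}\<close> by auto
        then show "c \<in> fst ` Z1" by force
      qed
      moreover have "E - {b0} \<subseteq> snd ` Z2"
      proof
        fix b assume b: "b \<in> E - {b0}"
        then obtain c where "c \<le> K" "coeff (P s c) b \<noteq> 0" using line by blast
        then have "(c, b) \<in> Z2" unfolding Z2_def Z_def using b by auto
        then show "b \<in> snd ` Z2" by force
      qed
      moreover have fin: "finite Z1" "finite Z2" using finZ unfolding Z1_def Z2_def by auto
      ultimately have "card N \<le> card Z1" "card (E - {b0}) \<le> card Z2"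
        using surj_card_le[of Z1 N fst] surj_card_le[of Z2 "E - {b0}" snd] by auto
      moreover have "card (E - {b0}) = v" using E b0 by simp
      moreover have "card (Z1 \<union> Z2) = card Z1 + card Z2"
        by (rule card_Un_disjoint[OF fin]) (auto simp: Z1_def Z2_def)
      moreover have "Z1 \<union> Z2 = Z" unfolding Z1_def Z2_def by blast
      moreover have "T s = card Z" unfolding T_card Z_def ..
      ultimately show ?thesis by simp
    qed
    have "\<exists>k. var_le (\<lambda>c. l (G s c)) k \<and> k + Suc (Suc v) + (s - s) \<le> (\<Sum>m\<in>{s..s}. T m)"
      if nz: "\<exists>c. l (G s c) \<noteq> 0"
    proof -
      obtain c0 where c0: "l (G s c0) \<noteq> 0" using nz by blast
      define h where "h c = - l (P s c)" for c
      have h: "h c = l (G s c) - (if c = 0 then 0 else l (G s (c - 1)))" for c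
        unfolding h_def P_eq lin_diff[OF l(1)] l(2) lin_shift_diff[OF l(1)] by (simp add: shift_diff_def)
      have "{c. h c \<noteq> 0} = N" unfolding h_def N_def by simp
      then have "var_le h (card N - 1)" using var_le_card[of h "card N - 1"] finN by simp
      moreover have "l (G s c) = 0" if "c \<ge> K" for c using Gfin that lin_0[OF l(1)] by simp
      ultimately obtain k' where "card N - 1 = Suc k'" "var_le (\<lambda>c. l (G s c)) k'"
        using var_le_div[of h "\<lambda>c. l (G s c)" K c0 "card N - 1"] h c0 by blast
      then show ?thesis using count by (intro exI[of _ k']) simp
    qed
    then show ?thesis unfolding good_def using l(1) by blast
  qed
  have "sg ^ Suc v dvd f" if "\<forall>l. good s (Suc (Suc v)) s l \<longrightarrow> l f = 0" for f
    using killing_functionals_separate[OF E(3,2), of f] good that by blast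
  then show ?thesis unfolding separated_def v_def[symmetric] s_def[symmetric] by simp
qed

text \<open>Row 0 of q consists of constants, so any functional only rescales it. Since (1 - z) q_0
  = 1 - p_0 has at most one sign change, q_0 has none. Thus every functional is good, and only the
  zero form escapes detection, whatever \<open>a\<close> is.\<close>

lemma separated_0: "separated a 0 1 0"
proof -
  have G0: "G 0 c = [:coeff (G 0 c) 0:]" for c using degG[of 0 c] by (metis degree_0_id le_zero_eq)
  obtain c1 where "P 0 c1 \<noteq> 0" "c1 \<le> K" using sum_P0 by (metis (no_types, lifting) atMost_iff sum.neutral zero_neq_one)
  then have T0: "1 \<le> T 0" using ncoef_pos[of "P 0 c1"] member_le_sum[of c1 "{..K}" "\<lambda>c. ncoef (P 0 c)"]
    unfolding T_def by simp
  have v: "var_le (\<lambda>c. coeff (G 0 c) 0) 0" if nz: "coeff (G 0 c0) 0 \<noteq> 0" for c0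
  proof -
    define h where "h c = (if c = 0 then 1 else 0) - coeff (P 0 c) 0" for c
    have h: "h c = coeff (G 0 c) 0 - (if c = 0 then 0 else coeff (G 0 (c - 1)) 0)" for c
      unfolding h_def P0 shift_diff_def by simp
    \<comment> \<open>Only the constant coefficient of 1 - p_0 can be positive.\<close>
    define e where "e c = (c = 0 \<and> 0 \<le> h 0)" for c :: nat
    have "sign_changes e \<subseteq> {0}" unfolding sign_changes_def e_def by auto
    then have "finite (sign_changes e)" "card (sign_changes e) \<le> 1"
      using card_mono[of "{0}"] by (auto intro: finite_subset)
    moreover have "compat e h" unfolding compat_def e_def h_def using pos[of 0] by auto
    ultimately have "var_le h 1" unfolding var_le_def by blast
    moreover have "coeff (G 0 c) 0 = 0" if "c \<ge> K" for c using Gfin that by simp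
    ultimately show ?thesis using var_le_div[of h "\<lambda>c. coeff (G 0 c) 0" K c0 1] h nz by auto
  qed
  have good: "good 0 1 0 l" if l: "lin l" for l
  proof -
    have lG: "l (G 0 c) = l 1 * coeff (G 0 c) 0" for c
      by (subst G0) (metis lin_smult[OF l] mult.commute mult.right_neutral one_pCons smult_0_right smult_pCons)
    have "var_le (\<lambda>c. l (G 0 c)) 0" if nz: "\<exists>c. l (G 0 c) \<noteq> 0"
    proof -
      obtain c0 where "coeff (G 0 c0) 0 \<noteq> 0" using nz lG by (metis mult_zero_right)
      then obtain e where e: "compat e (\<lambda>c. coeff (G 0 c) 0)" "finite (sign_changes e)" "card (sign_changes e) \<le> 0"
        using v unfolding var_le_def by blast
      define e' where "e' c = (e c = (0 \<le> l 1))" for c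
      have "sign_changes e' = sign_changes e" unfolding sign_changes_def e'_def by auto
      moreover have "compat e' (\<lambda>c. l (G 0 c))" using e(1) unfolding lG compat_def e'_def
        by (auto simp: mult_nonneg_nonneg mult_nonneg_nonpos mult_nonpos_nonneg mult_nonpos_nonpos not_le less_imp_le)
      ultimately show ?thesis using e(2,3) unfolding var_le_def by metis
    qed
    moreover have "0 + 1 + (0 - 0) \<le> (\<Sum>m\<in>{0..0}. T m)" using T0 by simp
    ultimately show ?thesis unfolding good_def using l by blast
  qed
  have "f = 0" if "\<forall>l. good 0 1 0 l \<longrightarrow> l f = 0" for f
  proof (rule poly_eqI)
    fix i
    have "lin (\<lambda>f. coeff f i)" unfolding lin_def by simp
    then show "coeff f i = coeff 0 i" using good that by fastforce
  qed
  then show ?thesis unfolding separated_def by blast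
qed

text \<open>Strong induction: the terms up to row j are counted by the inequality for j, those after
  it by a chain starting in row j + 1, where j is the last index with v_j - j > v_t - t. If there is
  no such j, the chain starts in row 0.\<close>

lemma rows_bound:
  assumes "t < M"
  shows "2 * t + 1 \<le> (\<Sum>m\<le>t. T m) + val t"
  using assms
proof (induction t rule: less_induct)
  case (less t)
  show ?case
  proof (cases "\<exists>i<t. val t + i < val i + t")
    case False
    have "val 0 = 0" using val_props(3)[of 0] less.prems by simp
    then have "t \<le> val t" using False less.prems by (cases "t = 0") (auto simp: not_less)
    moreover have "1 + (t - 0) \<le> (\<Sum>m\<in>{0..t}. T m)"
    \<comment> \<open>\<open>Suc M\<close> exceeds every valuation, so the non-divisibility
      condition holds in all rows.\<close>
    proof (rule chain_bound[OF separated_0[of "Suc M"]])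
      fix i assume i: "i \<le> t"
      then show "\<not> divides i (Suc M + (i - 0))" using divides_le[of i "Suc M + (i - 0)"] less.prems by auto
    qed simp
    ultimately show ?thesis by (simp add: atMost_atLeast0)
  next
    case True
    define j where "j = Max {i. i < t \<and> val t + i < val i + t}"
    have fin: "finite {i. i < t \<and> val t + i < val i + t}" by simp
    have ne: "{i. i < t \<and> val t + i < val i + t} \<noteq> {}" using True by blast
    have j: "j < t" "val t + j < val j + t" using Max_in[OF fin ne] unfolding j_def by auto
    have after: "val i + t \<le> val t + i" if "j < i" "i \<le> t" for i
    proof (rule ccontr)
      assume "\<not> val i + t \<le> val t + i"
      then have "i < t \<and> val t + i < val i + t" using that(2) by (cases "i = t") auto
      then show False using Max_ge[OF fin, of i] that(1) unfolding j_def[symmetric] by simp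
    qed
    \<comment> \<open>For j < i \<le> t maximality of j gives v_i - i \<le> v_t - t < v_j - j, hence
      v_i < v_j + i - j, which is the exponent required in row i.\<close>
    have nd: "\<not> divides i (Suc (val j) + (i - Suc j))" if "Suc j \<le> i" "i \<le> t" for i
      using val_props(2)[of i "Suc (val j) + (i - Suc j)"] after[of i] j that less.prems by fastforce
    have "separated (Suc (val j)) (Suc j) (Suc (Suc (val j))) (Suc j)"
      using separated_start[of j] nd[of "Suc j"] j(1) less.prems by simp
    then have "Suc (Suc (val j)) + (t - Suc j) \<le> (\<Sum>m\<in>{Suc j..t}. T m)"
    proof (rule chain_bound)
      show "Suc j \<le> t" using j(1) by simp
    qed (rule nd)
    moreover have "2 * j + 1 \<le> (\<Sum>m\<le>j. T m) + val j" using less.IH[of j] j(1) less.prems by simp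
    moreover have "(\<Sum>m\<le>t. T m) = (\<Sum>m\<le>j. T m) + (\<Sum>m\<in>{Suc j..t}. T m)"
    proof -
      have "{..t} = {..j} \<union> {Suc j..t}" using j(1) by auto
      then show ?thesis by (simp add: sum.union_disjoint[symmetric] ivl_disj_int)
    qed
    \<comment> \<open>The valuation of row j + 1 is nonnegative, so v_t - t is at least -(j +
      1).\<close>
    moreover have "t \<le> val t + Suc j" using after[of "Suc j"] j(1) by simp
    ultimately show ?thesis using j(1) by linarith
  qed
qed

theorem three_variable_bound: "2 * M + 1 \<le> (\<Sum>m\<le>M. T m)"
proof -
  define t where "t = M - 1"
  have M: "M = Suc t" using M1 unfolding t_def by simp
  have "\<And>c. shift_diff (G M) c = 0" unfolding shift_diff_def using GM by simp
  \<comment> \<open>Row M of q is zero, so the last row of p is \<sigma> times the row of q before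
    it.\<close>
  then have PM': "P M c = sg * G t c" for c using PS[of t c] unfolding M by simp
  obtain c where c: "P M c \<noteq> 0" using PM by blast
  then have cK: "c \<le> K" using Pfin[of c M] by (metis linorder_not_less)
  have "sg ^ val t dvd G t c" using val_props(1)[of t] unfolding divides_def M by simp
  then have "sg ^ Suc (val t) dvd P M c" unfolding PM' by (simp add: mult_dvd_mono)
  then have "Suc (Suc (val t)) \<le> ncoef (P M c)" using ncoef_sg_power c by blast
  also have "\<dots> \<le> T M" unfolding T_def using cK by (intro member_le_sum) auto
  finally show ?thesis using rows_bound[of t] unfolding M by simp
qed

end

section \<open>The quotient (1 - p) / (1 - s)\<close>

definition vars :: "nat \<Rightarrow> (nat \<Rightarrow> nat) \<Rightarrow> bool" where
  "vars n \<alpha> \<longleftrightarrow> (\<forall>i\<ge>n. \<alpha> i = 0)"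

definition level :: "nat \<Rightarrow> nat \<Rightarrow> (nat \<Rightarrow> nat) set" where
  "level n k = {\<alpha>. vars n \<alpha> \<and> tdeg n \<alpha> = k}"

definition mon :: "nat \<Rightarrow> (nat \<Rightarrow> nat) \<Rightarrow> (nat \<Rightarrow> real) \<Rightarrow> real" where
  "mon n \<alpha> x = (\<Prod>i<n. x i ^ \<alpha> i)"

definition hom_part :: "nat \<Rightarrow> ((nat \<Rightarrow> nat) \<Rightarrow> real) \<Rightarrow> nat \<Rightarrow> (nat \<Rightarrow> real) \<Rightarrow> real" where
  "hom_part n c k x = (\<Sum>\<alpha>\<in>level n k. c \<alpha> * mon n \<alpha> x)"

lemma tdeg_upd:
  assumes "i < n"
  shows "tdeg n (\<alpha>(i := k)) + \<alpha> i = tdeg n \<alpha> + k"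
proof -
  have "tdeg n \<alpha> = \<alpha> i + (\<Sum>j\<in>{..<n} - {i}. \<alpha> j)"
    unfolding tdeg_def using assms by (intro sum.remove) auto
  moreover have "tdeg n (\<alpha>(i := k)) = k + (\<Sum>j\<in>{..<n} - {i}. \<alpha> j)"
    unfolding tdeg_def using assms by (subst sum.remove[of _ i]) (auto intro!: sum.cong)
  ultimately show ?thesis by simp
qed

lemma le_tdeg: "i < n \<Longrightarrow> \<alpha> i \<le> tdeg n \<alpha>"
  unfolding tdeg_def by (rule member_le_sum) auto

lemma finite_level: "finite (level n k)"
proof -
  define S where "S = {\<alpha> :: nat \<Rightarrow> nat. \<forall>i. (i \<in> {..<n} \<longrightarrow> \<alpha> i \<in> {..k}) \<and> (i \<notin> {..<n} \<longrightarrow> \<alpha> i = 0)}"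
  have "finite S" unfolding S_def by (rule finite_set_of_finite_funs) auto
  moreover have "level n k \<subseteq> S"
  proof
    fix \<alpha> assume "\<alpha> \<in> level n k"
    then show "\<alpha> \<in> S" using le_tdeg[of _ n \<alpha>] unfolding level_def vars_def S_def by auto
  qed
  ultimately show ?thesis by (rule finite_subset[rotated])
qed

lemma level_0: "level n 0 = {\<lambda>_. 0}"
proof -
  have "\<alpha> = (\<lambda>_. 0)" if \<alpha>: "vars n \<alpha>" "tdeg n \<alpha> = 0" for \<alpha>
  proof
    fix i
    show "\<alpha> i = 0" using \<alpha> le_tdeg[of i n \<alpha>] unfolding vars_def by (cases "i < n") auto
  qed
  then show ?thesis unfolding level_def by (auto simp: vars_def tdeg_def)
qed

text \<open>The coefficients of the power series (1 - c) / (1 - (x_0 + ... + x_(n-1))).\<close>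
function quot :: "nat \<Rightarrow> ((nat \<Rightarrow> nat) \<Rightarrow> real) \<Rightarrow> (nat \<Rightarrow> nat) \<Rightarrow> real" where
  "quot n c \<alpha> = (if \<alpha> = (\<lambda>_. 0) then 1 else 0) - c \<alpha> +
     (\<Sum>i\<in>{i. i < n \<and> 0 < \<alpha> i}. quot n c (\<alpha>(i := \<alpha> i - 1)))"
  by pat_completeness auto
termination
proof (relation "measure (\<lambda>(n, c, \<alpha>). tdeg n \<alpha>)")
  fix n i and \<alpha> :: "nat \<Rightarrow> nat" and c :: "(nat \<Rightarrow> nat) \<Rightarrow> real"
  assume "i \<in> {i. i < n \<and> 0 < \<alpha> i}"
  then show "((n, c, \<alpha>(i := \<alpha> i - 1)), (n, c, \<alpha>)) \<in> measure (\<lambda>(n, c, \<alpha>). tdeg n \<alpha>)"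
    using tdeg_upd[of i n \<alpha> "\<alpha> i - 1"] by (simp, linarith)
qed simp

declare quot.simps [simp del]

section \<open>Homogeneous parts of the quotient\<close>

lemma mon_upd_Suc: "i < n \<Longrightarrow> mon n (\<beta>(i := Suc (\<beta> i))) x = x i * mon n \<beta> x"
proof -
  assume i: "i < n"
  have rem: "(\<Prod>j<n. f j) = f i * (\<Prod>j\<in>{..<n} - {i}. f j)" for f :: "nat \<Rightarrow> real"
    using i by (intro prod.remove) auto
  have "(\<Prod>j\<in>{..<n} - {i}. x j ^ (\<beta>(i := Suc (\<beta> i))) j) = (\<Prod>j\<in>{..<n} - {i}. x j ^ \<beta> j)"
    by (intro prod.cong) auto
  then show ?thesis unfolding mon_def rem by simp
qed

lemma hom_part_quot_0: "hom_part n (quot n c) 0 x = 1 - hom_part n c 0 x"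
proof -
  have "quot n c (\<lambda>_. 0) = 1 - c (\<lambda>_. 0)" by (subst quot.simps) simp
  then show ?thesis unfolding hom_part_def level_0 by (simp add: mon_def)
qed

lemma hom_part_quot_Suc:
  "hom_part n (quot n c) (Suc k) x = (\<Sum>i<n. x i) * hom_part n (quot n c) k x - hom_part n c (Suc k) x"
proof -
  have up: "(\<Sum>\<alpha>\<in>{\<alpha> \<in> level n (Suc k). 0 < \<alpha> i}. quot n c (\<alpha>(i := \<alpha> i - 1)) * mon n \<alpha> x)
      = x i * hom_part n (quot n c) k x" if i: "i < n" for i
  proof -
    have "(\<Sum>\<beta>\<in>level n k. quot n c \<beta> * (x i * mon n \<beta> x))
       = (\<Sum>\<alpha>\<in>{\<alpha> \<in> level n (Suc k). 0 < \<alpha> i}. quot n c (\<alpha>(i := \<alpha> i - 1)) * mon n \<alpha> x)"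
    proof (rule sum.reindex_bij_witness[of _ "\<lambda>\<alpha>. \<alpha>(i := \<alpha> i - 1)" "\<lambda>\<beta>. \<beta>(i := Suc (\<beta> i))"])
      fix \<beta> assume "\<beta> \<in> level n k"
      then show "\<beta>(i := Suc (\<beta> i)) \<in> {\<alpha> \<in> level n (Suc k). 0 < \<alpha> i}"
        using tdeg_upd[OF i, of \<beta> "Suc (\<beta> i)"] i unfolding level_def vars_def by auto
    next
      fix \<alpha> assume "\<alpha> \<in> {\<alpha> \<in> level n (Suc k). 0 < \<alpha> i}"
      then show "\<alpha>(i := \<alpha> i - 1) \<in> level n k"
        using tdeg_upd[OF i, of \<alpha> "\<alpha> i - 1"] i unfolding level_def vars_def by auto
    qed (auto simp: mon_upd_Suc[OF i])
    then show ?thesis unfolding hom_part_def by (simp add: sum_distrib_left mult.left_commute)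
  qed
  have "hom_part n (quot n c) (Suc k) x
      = (\<Sum>\<alpha>\<in>level n (Suc k). (\<Sum>i<n. if 0 < \<alpha> i then quot n c (\<alpha>(i := \<alpha> i - 1)) * mon n \<alpha> x else 0)
          - c \<alpha> * mon n \<alpha> x)"
    unfolding hom_part_def
  proof (rule sum.cong)
    fix \<alpha> assume \<alpha>: "\<alpha> \<in> level n (Suc k)"
    then have "\<alpha> \<noteq> (\<lambda>_. 0)" unfolding level_def by (auto simp: tdeg_def)
    moreover have "(\<Sum>i\<in>{i. i < n \<and> 0 < \<alpha> i}. quot n c (\<alpha>(i := \<alpha> i - 1))) * mon n \<alpha> x
        = (\<Sum>i<n. if 0 < \<alpha> i then quot n c (\<alpha>(i := \<alpha> i - 1)) * mon n \<alpha> x else 0)"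
      unfolding sum_distrib_right by (intro sum.mono_neutral_cong_left) auto
    ultimately show "quot n c \<alpha> * mon n \<alpha> x
       = (\<Sum>i<n. if 0 < \<alpha> i then quot n c (\<alpha>(i := \<alpha> i - 1)) * mon n \<alpha> x else 0) - c \<alpha> * mon n \<alpha> x"
      by (subst quot.simps) (simp add: algebra_simps)
  qed simp
  also have "\<dots> = (\<Sum>i<n. \<Sum>\<alpha>\<in>level n (Suc k). if 0 < \<alpha> i then quot n c (\<alpha>(i := \<alpha> i - 1)) * mon n \<alpha> x else 0)
      - hom_part n c (Suc k) x"
    unfolding sum_subtractf hom_part_def by (subst sum.swap) simp
  also have "(\<Sum>i<n. \<Sum>\<alpha>\<in>level n (Suc k). if 0 < \<alpha> i then quot n c (\<alpha>(i := \<alpha> i - 1)) * mon n \<alpha> x else 0)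
     = (\<Sum>i<n. x i * hom_part n (quot n c) k x)"
  proof (rule sum.cong)
    fix i assume "i \<in> {..<n}"
    then show "(\<Sum>\<alpha>\<in>level n (Suc k). if 0 < \<alpha> i then quot n c (\<alpha>(i := \<alpha> i - 1)) * mon n \<alpha> x else 0)
      = x i * hom_part n (quot n c) k x"
      using up[of i] unfolding sum.inter_filter[OF finite_level] by simp
  qed simp
  finally show ?thesis by (simp add: sum_distrib_right)
qed

text \<open>The unrolled recursion q_(k+1) = s q_k - p_(k+1). For k at least the degree of p the
  right side is s^k (1 - p(x / s)).\<close>

lemma hom_part_quot:
  "hom_part n (quot n c) k x = (\<Sum>i<n. x i) ^ k - (\<Sum>j\<le>k. hom_part n c j x * (\<Sum>i<n. x i) ^ (k - j))"
proof (induction k)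
  case 0 then show ?case by (simp add: hom_part_quot_0)
next
  case (Suc k)
  define s where "s = (\<Sum>i<n. x i)"
  have "(\<Sum>j\<le>k. hom_part n c j x * s ^ (Suc k - j)) = s * (\<Sum>j\<le>k. hom_part n c j x * s ^ (k - j))"
    unfolding sum_distrib_left by (intro sum.cong) (auto simp: Suc_diff_le)
  then show ?case unfolding hom_part_quot_Suc Suc.IH s_def[symmetric] by (simp add: algebra_simps)
qed

lemma hom_part_scale:
  assumes "s \<noteq> 0"
  shows "hom_part n c k (\<lambda>i. x i / s) = hom_part n c k x / s ^ k"
proof -
  have "mon n \<alpha> (\<lambda>i. x i / s) = mon n \<alpha> x / s ^ k" if "\<alpha> \<in> level n k" for \<alpha>
    using that unfolding mon_def level_def tdeg_def by (auto simp: power_divide prod_dividef power_sum)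
  then show ?thesis unfolding hom_part_def by (simp add: sum_divide_distrib)
qed

section \<open>The identity theorem for forms\<close>

lemma digits_unique:
  fixes a b :: "nat \<Rightarrow> nat"
  assumes "\<And>i. i < n \<Longrightarrow> a i < B" "\<And>i. i < n \<Longrightarrow> b i < B"
    and "(\<Sum>i<n. a i * B ^ i) = (\<Sum>i<n. b i * B ^ i)" and "i < n"
  shows "a i = b i"
  using assms
proof (induction n arbitrary: a b i)
  case (Suc n)
  have shift: "(\<Sum>i<Suc n. f i * B ^ i) = f 0 + B * (\<Sum>i<n. f (Suc i) * B ^ i)" for f :: "nat \<Rightarrow> nat"
    unfolding sum.lessThan_Suc_shift by (simp add: sum_distrib_left mult.left_commute)
  have eq: "a 0 + B * (\<Sum>i<n. a (Suc i) * B ^ i) = b 0 + B * (\<Sum>i<n. b (Suc i) * B ^ i)"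
    using Suc.prems(3) unfolding shift .
  have "a 0 = b 0"
    using arg_cong[OF eq, of "\<lambda>m. m mod B"] Suc.prems(1,2)[of 0] by simp
  moreover have "B \<noteq> 0" using Suc.prems(1)[of 0] by auto
  ultimately have "(\<Sum>i<n. a (Suc i) * B ^ i) = (\<Sum>i<n. b (Suc i) * B ^ i)" using eq by simp
  then have "a (Suc i) = b (Suc i)" if "i < n" for i
    using Suc.IH[of "\<lambda>i. a (Suc i)" "\<lambda>i. b (Suc i)" i] Suc.prems(1,2) that by simp
  then show ?case using \<open>a 0 = b 0\<close> Suc.prems(4) by (cases i) auto
qed simp

text \<open>Kronecker substitution x_i = T^(B^i) with B = k + 1 reduces the identity theorem to one
  variable.\<close>
lemma hom_part_eq_0:
  assumes "\<And>x. (\<And>i. i < n \<Longrightarrow> 0 < x i) \<Longrightarrow> hom_part n c k x = 0" and \<alpha>: "\<alpha> \<in> level n k"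
  shows "c \<alpha> = 0"
proof -
  define \<kappa> where "\<kappa> \<beta> = (\<Sum>i<n. \<beta> i * Suc k ^ i)" for \<beta> :: "nat \<Rightarrow> nat"
  define R where "R = (\<Sum>\<beta>\<in>level n k. monom (c \<beta>) (\<kappa> \<beta>))"
  have "poly R t = 0" if "t > 0" for t
  proof -
    have "mon n \<beta> (\<lambda>i. t ^ (Suc k ^ i)) = t ^ \<kappa> \<beta>" for \<beta>
      unfolding mon_def \<kappa>_def by (simp add: power_sum power_mult[symmetric] mult.commute)
    then have "poly R t = hom_part n c k (\<lambda>i. t ^ (Suc k ^ i))"
      unfolding R_def hom_part_def by (simp add: poly_sum poly_monom)
    then show ?thesis using assms(1) that by simp
  qed
  then have "{0<..} \<subseteq> {t. poly R t = 0}" by auto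
  then have "infinite {t. poly R t = 0}" using infinite_Ioi finite_subset by blast
  then have "R = 0" using poly_roots_finite by blast
  have "\<beta> = \<alpha>" if \<beta>: "\<beta> \<in> level n k" and eq: "\<kappa> \<beta> = \<kappa> \<alpha>" for \<beta>
  proof
    fix i
    show "\<beta> i = \<alpha> i"
    proof (cases "i < n")
      case True
      have "\<gamma> i < Suc k" if "\<gamma> \<in> level n k" "i < n" for \<gamma> i
        using le_tdeg[of i n \<gamma>] that unfolding level_def by simp
      then show ?thesis using digits_unique[of n \<beta> "Suc k" \<alpha> i] \<alpha> \<beta> eq True unfolding \<kappa>_def by blast
    next
      case False
      then show ?thesis using \<alpha> \<beta> unfolding level_def vars_def by simp
    qed
  qed
  then have "coeff R (\<kappa> \<alpha>) = (\<Sum>\<beta>\<in>level n k. if \<beta> = \<alpha> then c \<beta> else 0)"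
    unfolding R_def coeff_sum by (intro sum.cong) auto
  then show ?thesis using \<open>R = 0\<close> \<alpha> finite_level by simp
qed

section \<open>Elementary properties of H(n,d) and vanishing of q in high degrees\<close>

lemma H_class_support:
  assumes "c \<in> H_class n d" "c \<alpha> \<noteq> 0"
  shows "vars n \<alpha>" "tdeg n \<alpha> \<le> d"
proof -
  have fin: "finite (mon_support c)" and v: "\<forall>\<alpha>\<in>mon_support c. vars n \<alpha>"
    and m: "Max (tdeg n ` mon_support c) = d"
    using assms(1) unfolding H_class_def is_poly_def has_degree_def vars_def by auto
  have s: "\<alpha> \<in> mon_support c" using assms(2) unfolding mon_support_def by simp
  show "vars n \<alpha>" using v s by blast
  show "tdeg n \<alpha> \<le> d" using Max_ge[of "tdeg n ` mon_support c" "tdeg n \<alpha>"] fin s m by simp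
qed

lemma H_class_nonneg: "c \<in> H_class n d \<Longrightarrow> 0 \<le> c \<alpha>"
  unfolding H_class_def by auto

lemma H_class_finite: "c \<in> H_class n d \<Longrightarrow> finite (mon_support c)"
  unfolding H_class_def is_poly_def by auto

lemma H_class_top: 
  assumes "c \<in> H_class n d"
  shows "\<exists>\<alpha>\<in>level n d. c \<alpha> \<noteq> 0"
proof -
  have fin: "finite (mon_support c)" and ne: "mon_support c \<noteq> {}"
    and m: "Max (tdeg n ` mon_support c) = d"
    using assms(1) unfolding H_class_def is_poly_def has_degree_def by auto
  then have "d \<in> tdeg n ` mon_support c" using Max_in[of "tdeg n ` mon_support c"] by simp
  then obtain \<alpha> where "\<alpha> \<in> mon_support c" "tdeg n \<alpha> = d" by blast
  then show ?thesis using H_class_support(1)[OF assms] unfolding mon_support_def level_def by auto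
qed

lemma peval_hom_parts:
  assumes "c \<in> H_class n d"
  shows "peval n c x = (\<Sum>k\<le>d. hom_part n c k x)"
proof -
  have "(\<Sum>k\<le>d. \<Sum>\<alpha>\<in>{\<alpha> \<in> mon_support c. tdeg n \<alpha> = k}. c \<alpha> * mon n \<alpha> x)
      = (\<Sum>\<alpha>\<in>mon_support c. c \<alpha> * mon n \<alpha> x)"
    using H_class_finite[OF assms] H_class_support(2)[OF assms]
    by (intro sum.group) (auto simp: mon_support_def)
  moreover have "(\<Sum>\<alpha>\<in>{\<alpha> \<in> mon_support c. tdeg n \<alpha> = k}. c \<alpha> * mon n \<alpha> x) = hom_part n c k x" for k
    unfolding hom_part_def using H_class_support(1)[OF assms] finite_level
    by (intro sum.mono_neutral_left) (auto simp: mon_support_def level_def)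
  ultimately show ?thesis unfolding peval_def mon_def by simp
qed

text \<open>A positive point can be scaled into the hyperplane s = 1, where p = 1. By
  \<open>hom_part_quot\<close> the parts of q of degree at least d vanish at all positive points, so
  their coefficients are 0: q is a polynomial.\<close>

lemma quot_eq_0:
  assumes c: "c \<in> H_class n d" and n: "0 < n" and \<alpha>: "vars n \<alpha>" "d \<le> tdeg n \<alpha>"
  shows "quot n c \<alpha> = 0"
proof -
  define k where "k = tdeg n \<alpha>"
  have zero: "hom_part n (quot n c) k x = 0" if x: "\<And>i. i < n \<Longrightarrow> 0 < x i" for x
  proof -
  define s where "s = (\<Sum>i<n. x i)"
  have s: "s > 0" unfolding s_def using x n by (intro sum_pos) auto
  have "(\<Sum>i<n. x i / s) = 1" using s unfolding s_def by (simp add: sum_divide_distrib[symmetric])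
  then have "peval n c (\<lambda>i. x i / s) = 1" using c unfolding H_class_def by blast
  then have one: "(\<Sum>j\<le>d. hom_part n c j x / s ^ j) = 1"
    unfolding peval_hom_parts[OF c] using hom_part_scale[of s] s by simp
  have "hom_part n c j x = 0" if "d < j" for j
    unfolding hom_part_def using H_class_support(2)[OF c] that
    by (intro sum.neutral) (force simp: level_def)
  then have "(\<Sum>j\<le>k. hom_part n c j x * s ^ (k - j)) = (\<Sum>j\<le>d. hom_part n c j x * s ^ (k - j))"
    using \<alpha>(2) unfolding k_def by (intro sum.mono_neutral_right) auto
  also have "\<dots> = s ^ k * (\<Sum>j\<le>d. hom_part n c j x / s ^ j)"
    unfolding sum_distrib_left using s \<alpha>(2) unfolding k_def
    by (intro sum.cong) (auto simp: power_diff)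
  finally show ?thesis unfolding hom_part_quot s_def[symmetric] one by simp
  qed
  have "\<alpha> \<in> level n k" using \<alpha> unfolding level_def k_def by simp
  then show ?thesis using hom_part_eq_0[of n "quot n c" k \<alpha>] zero by blast
qed

section \<open>Forms divisible by a power of the sum of the variables\<close>

text \<open>Dehomogenisation of the binary form of degree t with coefficient \<open>f a b\<close> at
  x^a y^b, with x = u and y = 1.\<close>

definition pol :: "(nat \<Rightarrow> nat \<Rightarrow> real) \<Rightarrow> nat \<Rightarrow> real poly" where
  "pol f t = (\<Sum>a\<le>t. monom (f a (t - a)) a)"

lemma coeff_pol: "coeff (pol f t) a = (if a \<le> t then f a (t - a) else 0)"
  unfolding pol_def coeff_sum by simp

lemma pol_Suc:
  assumes "\<And>a b. a + b = Suc t \<Longrightarrow>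
    f' a b = (if a = 0 then 0 else f (a - 1) b) + (if b = 0 then 0 else f a (b - 1))"
  shows "pol f' (Suc t) = sg * pol f t"
proof (rule poly_eqI)
  fix a
  show "coeff (pol f' (Suc t)) a = coeff (sg * pol f t) a"
  proof (cases "a \<le> Suc t")
    case True
    then have "f' a (Suc t - a) = (if a = 0 then 0 else f (a - 1) (Suc t - a)) +
        (if Suc t - a = 0 then 0 else f a (Suc t - a - 1))" by (intro assms) simp
    then show ?thesis using True unfolding coeff_sg coeff_pol
      by (cases a) (auto simp: Suc_diff_le)
  next
    case False
    then show ?thesis unfolding coeff_sg coeff_pol by auto
  qed
qed

text \<open>The coefficients of h times the sum of the variables with index in I.\<close>

definition mult_sum :: "nat set \<Rightarrow> ((nat \<Rightarrow> nat) \<Rightarrow> real) \<Rightarrow> (nat \<Rightarrow> nat) \<Rightarrow> real" where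
  "mult_sum I h \<beta> = (\<Sum>i\<in>I. if \<beta> i = 0 then 0 else h (\<beta>(i := \<beta> i - 1)))"

lemma mult_sum_scale: "mult_sum I (\<lambda>\<beta>. r * h \<beta>) = (\<lambda>\<beta>. r * mult_sum I h \<beta>)"
  unfolding mult_sum_def by (rule ext) (auto simp: sum_distrib_left intro!: sum.cong)

lemma mult_sum_nonzero:
  assumes "mult_sum I h \<beta> \<noteq> 0"
  obtains i where "i \<in> I" "\<beta> i \<noteq> 0" "h (\<beta>(i := \<beta> i - 1)) \<noteq> 0"
proof -
  have "\<exists>i\<in>I. (if \<beta> i = 0 then 0 else h (\<beta>(i := \<beta> i - 1))) \<noteq> 0"
  proof (rule ccontr)
    assume "\<not> ?thesis"
    then have "mult_sum I h \<beta> = 0" unfolding mult_sum_def by (intro sum.neutral) blast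
    then show False using assms by contradiction
  qed
  then show ?thesis using that by (auto split: if_splits)
qed

text \<open>Initial forms with respect to the k-th variable.\<close>
lemma mult_sum_slice:
  assumes I: "finite I" "k \<in> I" and v: "\<And>\<beta>. h \<beta> \<noteq> 0 \<Longrightarrow> v \<le> \<beta> k"
  defines "h' \<equiv> (\<lambda>\<beta>. if \<beta> k = v then h \<beta> else 0)"
  shows "((mult_sum (I - {k}) ^^ J) h') \<beta> = (if \<beta> k = v then ((mult_sum I ^^ J) h) \<beta> else 0)"
    and "((mult_sum I ^^ J) h) \<beta> \<noteq> 0 \<Longrightarrow> v \<le> \<beta> k"
proof (induction J arbitrary: \<beta>)
  case 0
  { case 1 show ?case by (simp add: h'_def) }
  { case 2 then show ?case using v by simp }
next
  case (Suc J)
  define f where "f = (mult_sum I ^^ J) h"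
  define f' where "f' = (mult_sum (I - {k}) ^^ J) h'"
  have f': "f' \<beta> = (if \<beta> k = v then f \<beta> else 0)" for \<beta> unfolding f_def f'_def by (rule Suc.IH)
  have f: "v \<le> \<beta> k" if "f \<beta> \<noteq> 0" for \<beta> using Suc.IH(2) that unfolding f_def .
  { case 1
    have "mult_sum (I - {k}) f' \<beta> = (if \<beta> k = v then mult_sum I f \<beta> else 0)"
    proof (cases "\<beta> k = v")
      case True
      \<comment> \<open>Multiplication by x_k cannot reach the slice of minimal exponent: the source
        would have exponent v - 1.\<close>
      have k0: "(if \<beta> k = 0 then 0 else f (\<beta>(k := \<beta> k - 1))) = 0"
      proof (cases "f (\<beta>(k := \<beta> k - 1)) = 0")
        case False
        then show ?thesis using f[OF False] True by simp
      qed simp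
      have "mult_sum I f \<beta> = (\<Sum>i\<in>I - {k}. if \<beta> i = 0 then 0 else f (\<beta>(i := \<beta> i - 1)))"
        unfolding mult_sum_def sum.remove[OF I] k0 by simp
      also have "\<dots> = mult_sum (I - {k}) f' \<beta>"
        unfolding mult_sum_def f' using True by (intro sum.cong) auto
      finally show ?thesis using True by simp
    next
      case False
      then show ?thesis unfolding mult_sum_def f' by (auto intro!: sum.neutral split: if_splits)
    qed
    then show ?case unfolding f_def f'_def by simp }
  { case 2
    then have "mult_sum I f \<beta> \<noteq> 0" unfolding f_def by simp
    then obtain i where "f (\<beta>(i := \<beta> i - 1)) \<noteq> 0" by (rule mult_sum_nonzero)
    from f[OF this] show ?case by (auto split: if_splits) }
qed

text \<open>Models J + 1 monomials on an edge of the Newton polytope along which only x_i and x_l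
  vary.\<close>

definition edge :: "nat \<Rightarrow> nat \<Rightarrow> nat \<Rightarrow> (nat \<Rightarrow> nat) set \<Rightarrow> bool" where
  "edge i l J S \<longleftrightarrow> finite S \<and> card S = Suc J \<and> inj_on (\<lambda>\<beta>. \<beta> i) S \<and>
    (\<forall>\<beta>\<in>S. \<forall>\<beta>'\<in>S. \<forall>k. k \<noteq> i \<and> k \<noteq> l \<longrightarrow> \<beta> k = \<beta>' k)"

text \<open>Only the homogeneous component through \<open>\<beta>0\<close> in the two variables is
  followed. Dehomogenised, it acquires a factor \<open>sg ^ J\<close>, so
  \<open>ncoef_sg_power\<close> yields J + 1 monomials.\<close>

lemma mult_sum_edge_base:
  assumes il: "i \<noteq> l" and h: "h \<beta>0 \<noteq> 0"
  shows "\<exists>S\<subseteq>{\<beta>. ((mult_sum {i, l} ^^ J) h) \<beta> \<noteq> 0}. edge i l J S"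
proof -
  define line where "line a b = \<beta>0(i := a, l := b)" for a b
  have line_vals: "line a b i = a" "line a b l = b" "(line a b)(i := a') = line a' b"
    "(line a b)(l := b') = line a b'" for a b a' b' using il unfolding line_def by auto
  define s where "s = \<beta>0 i + \<beta>0 l"
  define f where "f e a b = ((mult_sum {i, l} ^^ e) h) (line a b)" for e a b
  have "pol (f e) (s + e) = sg ^ e * pol (f 0) s" for e
  proof (induction e)
    case (Suc e)
    have "f (Suc e) a b = (if a = 0 then 0 else f e (a - 1) b) + (if b = 0 then 0 else f e a (b - 1))" for a b
    proof -
      have two: "(\<Sum>x\<in>{i, l}. F x) = F i + F l" for F :: "nat \<Rightarrow> real" using il by simp
      have "f (Suc e) a b = mult_sum {i, l} ((mult_sum {i, l} ^^ e) h) (line a b)" unfolding f_def by simp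
      also have "\<dots> = (if a = 0 then 0 else f e (a - 1) b) + (if b = 0 then 0 else f e a (b - 1))"
        unfolding mult_sum_def[of "{i, l}" "(mult_sum {i, l} ^^ e) h"] f_def
        unfolding two line_vals ..
      finally show ?thesis .
    qed
    then have "pol (f (Suc e)) (Suc (s + e)) = sg * pol (f e) (s + e)" by (rule pol_Suc)
    then show ?case using Suc.IH by (simp add: mult.assoc)
  qed simp
  from this[of J] have "sg ^ J dvd pol (f J) (s + J)" by simp
  moreover have "pol (f J) (s + J) \<noteq> 0"
  proof -
    have "line (\<beta>0 i) (\<beta>0 l) = \<beta>0" unfolding line_def by simp
    then have "coeff (pol (f 0) s) (\<beta>0 i) \<noteq> 0" unfolding coeff_pol f_def s_def using h by simp
    then have "pol (f 0) s \<noteq> 0" by auto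
    then show ?thesis using \<open>pol (f J) (s + J) = sg ^ J * pol (f 0) s\<close> by simp
  qed
  ultimately have "Suc J \<le> card {a. coeff (pol (f J) (s + J)) a \<noteq> 0}"
    using ncoef_sg_power unfolding ncoef_def by blast
  then obtain A where A: "A \<subseteq> {a. coeff (pol (f J) (s + J)) a \<noteq> 0}" "card A = Suc J" "finite A"
    by (metis (no_types, lifting) obtain_subset_with_card_n)
  define S where "S = (\<lambda>a. line a (s + J - a)) ` A"
  have li: "line a b i = a" for a b using il unfolding line_def by simp
  have "S \<subseteq> {\<beta>. ((mult_sum {i, l} ^^ J) h) \<beta> \<noteq> 0}"
    using A(1) unfolding S_def coeff_pol f_def by (auto split: if_splits)
  moreover have "finite S" using A(3) unfolding S_def by simp
  moreover have "inj_on (\<lambda>a. line a (s + J - a)) A" by (rule inj_onI) (metis li)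
  then have "card S = Suc J" unfolding S_def using A(2) by (simp add: card_image)
  moreover have "inj_on (\<lambda>\<beta>. \<beta> i) S" unfolding S_def by (auto simp: inj_on_def li)
  moreover have "\<forall>\<beta>\<in>S. \<forall>\<beta>'\<in>S. \<forall>k. k \<noteq> i \<and> k \<noteq> l \<longrightarrow> \<beta> k = \<beta>' k" unfolding S_def line_def by auto
  ultimately show ?thesis unfolding edge_def by blast
qed

lemma slice_min:
  fixes h :: "(nat \<Rightarrow> nat) \<Rightarrow> real"
  assumes "h \<beta>0 \<noteq> 0"
  obtains v \<beta>1 where "\<And>\<beta>. h \<beta> \<noteq> 0 \<Longrightarrow> v \<le> \<beta> k" "h \<beta>1 \<noteq> 0" "\<beta>1 k = v"
proof -
  define v where "v = (LEAST v. \<exists>\<beta>. h \<beta> \<noteq> 0 \<and> \<beta> k = v)"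
  have "\<exists>v \<beta>. h \<beta> \<noteq> 0 \<and> \<beta> k = v" using assms by blast
  then have "\<exists>\<beta>. h \<beta> \<noteq> 0 \<and> \<beta> k = v" unfolding v_def by (rule LeastI_ex)
  moreover have "v \<le> \<beta> k" if "h \<beta> \<noteq> 0" for \<beta> unfolding v_def by (rule Least_le) (use that in blast)
  ultimately show ?thesis using that by blast
qed

text \<open>Passing to the initial form with respect to every other variable keeps the J factors and
  leaves two variables.\<close>

lemma mult_sum_edge:
  assumes "finite I" "i \<in> I" "l \<in> I" "i \<noteq> l" "h \<beta>0 \<noteq> 0"
  shows "\<exists>S\<subseteq>{\<beta>. ((mult_sum I ^^ J) h) \<beta> \<noteq> 0}. edge i l J S"
  using assms
proof (induction "card I" arbitrary: I h \<beta>0 rule: less_induct)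
  case less
  show ?case
  proof (cases "I = {i, l}")
    case True
    then show ?thesis using mult_sum_edge_base[of i l h \<beta>0 J] less.prems(4,5) by blast
  next
    case False
    then obtain k where k: "k \<in> I" "k \<noteq> i" "k \<noteq> l" using less.prems by blast
    obtain v \<beta>1 where v: "\<And>\<beta>. h \<beta> \<noteq> 0 \<Longrightarrow> v \<le> \<beta> k" "h \<beta>1 \<noteq> 0" "\<beta>1 k = v"
      using slice_min[of h \<beta>0 k] less.prems(5) by blast
    define h' where "h' = (\<lambda>\<beta>. if \<beta> k = v then h \<beta> else 0)"
    have "card (I - {k}) < card I" using less.prems(1) k(1) by (rule card_Diff1_less)
    moreover have "h' \<beta>1 \<noteq> 0" using v unfolding h'_def by simp
    moreover have "finite (I - {k})" "i \<in> I - {k}" "l \<in> I - {k}" using less.prems k by auto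
    ultimately have "\<exists>S\<subseteq>{\<beta>. ((mult_sum (I - {k}) ^^ J) h') \<beta> \<noteq> 0}. edge i l J S"
      using less.hyps less.prems(4) by blast
    then obtain S where S: "S \<subseteq> {\<beta>. ((mult_sum (I - {k}) ^^ J) h') \<beta> \<noteq> 0}" "edge i l J S" by blast
    have "S \<subseteq> {\<beta>. ((mult_sum I ^^ J) h) \<beta> \<noteq> 0}"
    proof
      fix \<beta> assume "\<beta> \<in> S"
      then have "((mult_sum (I - {k}) ^^ J) h') \<beta> \<noteq> 0" using S(1) by blast
      moreover have "((mult_sum (I - {k}) ^^ J) h') \<beta> = (if \<beta> k = v then ((mult_sum I ^^ J) h) \<beta> else 0)"
        unfolding h'_def by (rule mult_sum_slice(1)) (use less.prems(1) k v(1) in blast)+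
      ultimately show "\<beta> \<in> {\<beta>. ((mult_sum I ^^ J) h) \<beta> \<noteq> 0}" by (auto split: if_splits)
    qed
    then show ?thesis using S(2) by blast
  qed
qed

text \<open>For three variables, three edges with J + 1 monomials each meet pairwise in at most one,
  so at least 3 J remain. Each further variable x_k adds J: the slice of minimal exponent is counted
  by induction, and an edge along which x_k varies has J monomials outside it.\<close>

lemma mult_sum_card:
  assumes "finite I" "3 \<le> card I" "h \<beta>0 \<noteq> 0" "finite {\<beta>. ((mult_sum I ^^ J) h) \<beta> \<noteq> 0}"
    and "\<And>\<beta>. ((mult_sum I ^^ J) h) \<beta> \<noteq> 0 \<Longrightarrow> (\<Sum>i\<in>I. \<beta> i) = t \<and> (\<forall>i. i \<notin> I \<longrightarrow> \<beta> i = w i)"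
  shows "card I * J \<le> card {\<beta>. ((mult_sum I ^^ J) h) \<beta> \<noteq> 0}"
  using assms
proof (induction "card I" arbitrary: I h \<beta>0 t w rule: less_induct)
  case less
  define X where "X = {\<beta>. ((mult_sum I ^^ J) h) \<beta> \<noteq> 0}"
  have finX: "finite X" using less.prems(4) unfolding X_def .
  have homX: "(\<Sum>i\<in>I. \<beta> i) = t" "\<And>i. i \<notin> I \<Longrightarrow> \<beta> i = w i" if "\<beta> \<in> X" for \<beta>
    using less.prems(5) that unfolding X_def by blast+
  show ?case
  proof (cases "card I = 3")
    case True
    then obtain a b c where I: "I = {a, b, c}" "a \<noteq> b" "b \<noteq> c" "a \<noteq> c" by (metis card_3_iff)
    obtain S1 where S1: "S1 \<subseteq> X" "edge a b J S1"
      using mult_sum_edge[of I a b h \<beta>0 J] less.prems(1,3) I unfolding X_def by blast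
    obtain S2 where S2: "S2 \<subseteq> X" "edge b c J S2"
      using mult_sum_edge[of I b c h \<beta>0 J] less.prems(1,3) I unfolding X_def by blast
    obtain S3 where S3: "S3 \<subseteq> X" "edge a c J S3"
      using mult_sum_edge[of I a c h \<beta>0 J] less.prems(1,3) I unfolding X_def by blast
    note ed = S1(2)[unfolded edge_def] S2(2)[unfolded edge_def] S3(2)[unfolded edge_def]
    \<comment> \<open>By homogeneity two of the three exponents determine the third.\<close>
    have eqI: "\<beta> = \<beta>'" if "\<beta> \<in> X" "\<beta>' \<in> X" "\<beta> x = \<beta>' x" "\<beta> y = \<beta>' y" "{x, y, z} = I" "x \<noteq> y" "y \<noteq> z" "x \<noteq> z" for \<beta> \<beta>' x y z
    proof
      fix i
      have "\<beta> x + \<beta> y + \<beta> z = \<beta>' x + \<beta>' y + \<beta>' z"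
        using homX(1)[OF that(1)] homX(1)[OF that(2)] that(5)[symmetric] that(6-8) by simp
      then have "\<beta> z = \<beta>' z" using that(3,4) by simp
      then show "\<beta> i = \<beta>' i" using that homX(2)[OF that(1), of i] homX(2)[OF that(2), of i] by (cases "i \<in> I") auto
    qed
    have i12: "card (S1 \<inter> S2) \<le> 1"
    proof (rule card_le_Suc0_iff_eq[THEN iffD2, folded One_nat_def])
      show "\<forall>\<beta>\<in>S1 \<inter> S2. \<forall>\<beta>'\<in>S1 \<inter> S2. \<beta> = \<beta>'"
      proof (intro ballI)
        fix \<beta> \<beta>' assume "\<beta> \<in> S1 \<inter> S2" "\<beta>' \<in> S1 \<inter> S2"
        moreover have "\<beta> a = \<beta>' a" "\<beta> c = \<beta>' c" using ed I(2-4) calculation by (metis Int_iff)+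
        moreover have "{a, c, b} = I" using I(1) by auto
        ultimately show "\<beta> = \<beta>'" using eqI[of \<beta> \<beta>' a c b] S1(1) I(2-4) by blast
      qed
    qed (use ed in simp)
    have i13: "card (S1 \<inter> S3) \<le> 1"
    proof (rule card_le_Suc0_iff_eq[THEN iffD2, folded One_nat_def])
      show "\<forall>\<beta>\<in>S1 \<inter> S3. \<forall>\<beta>'\<in>S1 \<inter> S3. \<beta> = \<beta>'"
      proof (intro ballI)
        fix \<beta> \<beta>' assume "\<beta> \<in> S1 \<inter> S3" "\<beta>' \<in> S1 \<inter> S3"
        moreover have "\<beta> b = \<beta>' b" "\<beta> c = \<beta>' c" using ed I(2-4) calculation by (metis Int_iff)+
        moreover have "{b, c, a} = I" using I(1) by auto
        ultimately show "\<beta> = \<beta>'" using eqI[of \<beta> \<beta>' b c a] S1(1) I(2-4) by blast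
      qed
    qed (use ed in simp)
    have i23: "card (S2 \<inter> S3) \<le> 1"
    proof (rule card_le_Suc0_iff_eq[THEN iffD2, folded One_nat_def])
      show "\<forall>\<beta>\<in>S2 \<inter> S3. \<forall>\<beta>'\<in>S2 \<inter> S3. \<beta> = \<beta>'"
      proof (intro ballI)
        fix \<beta> \<beta>' assume "\<beta> \<in> S2 \<inter> S3" "\<beta>' \<in> S2 \<inter> S3"
        moreover have "\<beta> a = \<beta>' a" "\<beta> b = \<beta>' b" using ed I(2-4) calculation by (metis Int_iff)+
        moreover have "{a, b, c} = I" using I(1) by auto
        ultimately show "\<beta> = \<beta>'" using eqI[of \<beta> \<beta>' a b c] S2(1) I(2-4) by blast
      qed
    qed (use ed in simp)
    have "card (S1 \<union> S2) + card (S1 \<inter> S2) = card S1 + card S2"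
      using card_Un_Int[of S1 S2] ed by simp
    moreover have "card ((S1 \<union> S2) \<union> S3) + card ((S1 \<union> S2) \<inter> S3) = card (S1 \<union> S2) + card S3"
      using card_Un_Int[of "S1 \<union> S2" S3] ed by simp
    moreover have "card ((S1 \<union> S2) \<inter> S3) \<le> card (S1 \<inter> S3) + card (S2 \<inter> S3)"
      unfolding Int_Un_distrib2 by (rule card_Un_le)
    moreover have "card ((S1 \<union> S2) \<union> S3) \<le> card X" using finX S1(1) S2(1) S3(1) by (intro card_mono) auto
    ultimately show ?thesis unfolding X_def[symmetric] using i12 i13 i23 ed True by simp
  next
    case False
    then have c4: "4 \<le> card I" using less.prems(2) by simp
    then have "I \<noteq> {}" by auto
    then obtain k where k: "k \<in> I" by blast
    have ck: "card (I - {k}) = card I - 1" using less.prems(1) k by simp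
    then have "I - {k} \<noteq> {}" using c4 by fastforce
    then obtain l where l: "l \<in> I" "l \<noteq> k" by blast
    obtain v \<beta>1 where v: "\<And>\<beta>. h \<beta> \<noteq> 0 \<Longrightarrow> v \<le> \<beta> k" "h \<beta>1 \<noteq> 0" "\<beta>1 k = v"
      using slice_min[of h \<beta>0 k] less.prems(3) by blast
    define h' where "h' = (\<lambda>\<beta>. if \<beta> k = v then h \<beta> else 0)"
    have slice: "((mult_sum (I - {k}) ^^ J) h') \<beta> \<noteq> 0 \<longleftrightarrow> \<beta> k = v \<and> \<beta> \<in> X" for \<beta>
    proof -
      have "((mult_sum (I - {k}) ^^ J) h') \<beta> = (if \<beta> k = v then ((mult_sum I ^^ J) h) \<beta> else 0)"
        unfolding h'_def by (rule mult_sum_slice(1)) (use less.prems(1) k v(1) in blast)+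
      then show ?thesis unfolding X_def by auto
    qed
    have "card (I - {k}) * J \<le> card {\<beta>. ((mult_sum (I - {k}) ^^ J) h') \<beta> \<noteq> 0}"
    \<comment> \<open>In the slice x_k has the constant exponent v: it leaves the degree and joins
      the fixed exponents.\<close>
    proof (rule less.hyps[of _ _ \<beta>1 "t - v" "w(k := v)"])
      show "card (I - {k}) < card I" using less.prems(1) k by (rule card_Diff1_less)
      show "finite (I - {k})" "3 \<le> card (I - {k})" using less.prems(1) ck c4 by auto
      show "h' \<beta>1 \<noteq> 0" using v unfolding h'_def by simp
      show "finite {\<beta>. ((mult_sum (I - {k}) ^^ J) h') \<beta> \<noteq> 0}" unfolding slice using finX by simp
      fix \<beta> assume "((mult_sum (I - {k}) ^^ J) h') \<beta> \<noteq> 0"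
      then have \<beta>: "\<beta> k = v" "\<beta> \<in> X" unfolding slice by auto
      have "(\<Sum>i\<in>I. \<beta> i) = \<beta> k + (\<Sum>i\<in>I - {k}. \<beta> i)" using less.prems(1) k by (rule sum.remove)
      then show "(\<Sum>i\<in>I - {k}. \<beta> i) = t - v \<and> (\<forall>i. i \<notin> I - {k} \<longrightarrow> \<beta> i = (w(k := v)) i)"
        using homX[OF \<beta>(2)] \<beta>(1) by auto
    qed
    then have one: "(card I - 1) * J \<le> card {\<beta> \<in> X. \<beta> k = v}"
      unfolding slice ck by (simp add: conj_commute)
    obtain S where "S \<subseteq> X" "edge k l J S"
      using mult_sum_edge[of I k l h \<beta>0 J] less.prems(1,3) k l unfolding X_def by blast
    then have S: "S \<subseteq> X" "finite S" "card S = Suc J" "inj_on (\<lambda>\<beta>. \<beta> k) S" unfolding edge_def by auto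
    \<comment> \<open>Exponents of x_k are distinct along the edge, so it meets the slice at most
      once.\<close>
    have "card {\<beta> \<in> S. \<beta> k = v} \<le> 1"
      using S(2,4) by (intro card_le_Suc0_iff_eq[THEN iffD2, folded One_nat_def]) (auto simp: inj_on_def)
    moreover have "card {\<beta> \<in> S. \<beta> k = v} + card {\<beta> \<in> S. \<beta> k \<noteq> v} = card S"
      using S(2) by (subst card_Un_disjoint[symmetric]) (auto intro!: arg_cong[of _ _ card])
    ultimately have "J \<le> card {\<beta> \<in> S. \<beta> k \<noteq> v}" using S(3) by simp
    also have "\<dots> \<le> card {\<beta> \<in> X. \<beta> k \<noteq> v}" using S(1) finX by (intro card_mono) auto
    finally have two: "J \<le> card {\<beta> \<in> X. \<beta> k \<noteq> v}" .
    have "card {\<beta> \<in> X. \<beta> k = v} + card {\<beta> \<in> X. \<beta> k \<noteq> v} = card X"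
      using finX by (subst card_Un_disjoint[symmetric]) (auto intro!: arg_cong[of _ _ card])
    then have "(card I - 1) * J + J \<le> card X" using one two by linarith
    moreover have "(card I - 1) * J + J = card I * J" using c4 by (cases "card I") auto
    ultimately show ?thesis unfolding X_def by simp
  qed
qed

section \<open>Rows in at least four variables\<close>

lemma quot_rec:
  "c \<alpha> = (if \<alpha> = (\<lambda>_. 0) then 1 else 0) - quot n c \<alpha> + mult_sum {..<n} (quot n c) \<alpha>"
proof -
  have "(\<Sum>i\<in>{i. i < n \<and> 0 < \<alpha> i}. quot n c (\<alpha>(i := \<alpha> i - 1))) = mult_sum {..<n} (quot n c) \<alpha>"
    unfolding mult_sum_def by (intro sum.mono_neutral_cong_left) auto
  then show ?thesis by (subst quot.simps) simp
qed

lemma mult_sum_pow_zero: "(mult_sum I ^^ J) (\<lambda>_. 0) = (\<lambda>_. 0)"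
proof (induction J)
  case (Suc J)
  have "mult_sum I (\<lambda>_. 0) = (\<lambda>_. 0)" by (rule ext) (simp add: mult_sum_def)
  then show ?case using Suc.IH by simp
qed simp

definition rowdeg :: "nat \<Rightarrow> nat \<Rightarrow> (nat \<Rightarrow> nat) \<Rightarrow> nat" where
  "rowdeg n j \<alpha> = tdeg n \<alpha> - \<alpha> j"

lemma rowdeg_upd: "j < n \<Longrightarrow> rowdeg n j (\<alpha>(j := k)) = rowdeg n j \<alpha>"
  using tdeg_upd[of j n \<alpha> k] le_tdeg[of j n \<alpha>] unfolding rowdeg_def by simp

text \<open>Binomial weights extract the k-th Taylor coefficient at z = 1. The factor z - 1 lowers
  the order by one; the last term is due to the truncation at d.\<close>

lemma sum_abel:
  fixes Q :: "nat \<Rightarrow> real"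
  shows "(\<Sum>x\<le>d. of_nat (x choose k) * ((if x = 0 then 0 else Q (x - 1)) - Q x))
    = (if k = 0 then 0 else \<Sum>x\<le>d. of_nat (x choose (k - 1)) * Q x) - of_nat (Suc d choose k) * Q d"
proof (induction d)
  case 0 show ?case by (cases k) auto
next
  case (Suc d)
  show ?case
  proof (cases k)
    case 0
    then show ?thesis using Suc.IH by simp
  next
    case (Suc m)
    then show ?thesis using Suc.IH by (simp add: algebra_simps)
  qed
qed

locale hyperplane_polynomial =
  fixes n d j :: nat and c :: "(nat \<Rightarrow> nat) \<Rightarrow> real"
  assumes cH: "c \<in> H_class n d" and jn: "j < n"
begin

text \<open>The k-th Taylor coefficient at z = 1 of row t, where z = x_j and \<open>\<beta>\<close>
  lists the other exponents. Exponents outside the row get 0, so that identities with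
  \<open>mult_sum\<close> hold for all \<open>\<beta>\<close>.\<close>

definition moment :: "nat \<Rightarrow> nat \<Rightarrow> ((nat \<Rightarrow> nat) \<Rightarrow> real) \<Rightarrow> (nat \<Rightarrow> nat) \<Rightarrow> real" where
  "moment k t f \<beta> = (if vars n \<beta> \<and> \<beta> j = 0 \<and> tdeg n \<beta> = t
     then \<Sum>x\<le>d. of_nat (x choose k) * f (\<beta>(j := x)) else 0)"

definition I :: "nat set" where "I = {..<n} - {j}"

definition R :: "nat \<Rightarrow> (nat \<Rightarrow> nat) set" where
  "R t = {\<alpha> \<in> mon_support c. rowdeg n j \<alpha> = t}"

lemma finite_I: "finite I" unfolding I_def by simp

text \<open>The Taylor expansion at z = 1 of p_(t+1) = \<sigma> q_t + (z - 1) q_(t+1).\<close>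

lemma moment_Suc:
  "moment k (Suc t) c \<beta> = mult_sum I (moment k t (quot n c)) \<beta>
     + (if k = 0 then 0 else moment (k - 1) (Suc t) (quot n c) \<beta>)"
proof (cases "vars n \<beta> \<and> \<beta> j = 0 \<and> tdeg n \<beta> = Suc t")
  case False
  have "mult_sum I (moment k t (quot n c)) \<beta> = 0"
  proof (rule ccontr)
    assume "\<not> ?thesis"
    then obtain i where i: "i \<in> I" "\<beta> i \<noteq> 0" "moment k t (quot n c) (\<beta>(i := \<beta> i - 1)) \<noteq> 0"
      by (rule mult_sum_nonzero)
    then have "vars n (\<beta>(i := \<beta> i - 1))" "(\<beta>(i := \<beta> i - 1)) j = 0" "tdeg n (\<beta>(i := \<beta> i - 1)) = t"
      unfolding moment_def by (auto split: if_splits)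
    moreover have "i < n" "i \<noteq> j" using i(1) unfolding I_def by auto
    ultimately show False using False i(2) tdeg_upd[of i n \<beta> "\<beta> i - 1"] unfolding vars_def by auto
  qed
  then show ?thesis using False unfolding moment_def by auto
next
  case True
  define q where "q = quot n c"
  define Q where "Q x = q (\<beta>(j := x))" for x
  define W where "W i x = q ((\<beta>(i := \<beta> i - 1))(j := x))" for i x
  have td: "tdeg n (\<beta>(j := x)) = Suc t + x" for x using tdeg_upd[OF jn, of \<beta> x] True by simp
  have vj: "vars n (\<beta>(j := x))" for x using True jn unfolding vars_def by auto
  have c_eq: "c (\<beta>(j := x)) = ((if x = 0 then 0 else Q (x - 1)) - Q x) + (\<Sum>i\<in>I. if \<beta> i = 0 then 0 else W i x)" for x
  proof -
    have "\<beta>(j := x) \<noteq> (\<lambda>_. 0)"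
    proof
      assume "\<beta>(j := x) = (\<lambda>_. 0)"
      then have "tdeg n (\<beta>(j := x)) = 0" by (simp add: tdeg_def)
      then show False using td[of x] by simp
    qed
    moreover have "mult_sum {..<n} q (\<beta>(j := x)) = (if x = 0 then 0 else Q (x - 1)) +
        (\<Sum>i\<in>I. if \<beta> i = 0 then 0 else W i x)"
    proof -
      have "mult_sum {..<n} q (\<beta>(j := x)) =
          (if (\<beta>(j := x)) j = 0 then 0 else q ((\<beta>(j := x))(j := (\<beta>(j := x)) j - 1))) +
          (\<Sum>i\<in>I. if (\<beta>(j := x)) i = 0 then 0 else q ((\<beta>(j := x))(i := (\<beta>(j := x)) i - 1)))"
        unfolding mult_sum_def I_def using jn by (intro sum.remove) auto
      moreover have "(\<Sum>i\<in>I. if (\<beta>(j := x)) i = 0 then 0 else q ((\<beta>(j := x))(i := (\<beta>(j := x)) i - 1)))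
          = (\<Sum>i\<in>I. if \<beta> i = 0 then 0 else W i x)"
      proof (rule sum.cong)
        fix i assume "i \<in> I"
        then have "i \<noteq> j" unfolding I_def by simp
        then have "(\<beta>(j := x))(i := \<beta> i - 1) = (\<beta>(i := \<beta> i - 1))(j := x)" by (rule fun_upd_twist[symmetric])
        then show "(if (\<beta>(j := x)) i = 0 then 0 else q ((\<beta>(j := x))(i := (\<beta>(j := x)) i - 1)))
            = (if \<beta> i = 0 then 0 else W i x)" unfolding W_def using \<open>i \<noteq> j\<close> by simp
      qed simp
      ultimately show ?thesis unfolding Q_def by simp
    qed
    ultimately show ?thesis using quot_rec[of c "\<beta>(j := x)" n] unfolding q_def[symmetric] Q_def by simp
  qed
  \<comment> \<open>The boundary term of the Abel summation vanishes because q has degree below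
    d.\<close>
  have Qd: "Q d = 0" unfolding Q_def q_def using quot_eq_0[OF cH _ vj] td jn by simp
  have "moment k (Suc t) c \<beta> = (\<Sum>x\<le>d. of_nat (x choose k) * c (\<beta>(j := x)))"
    unfolding moment_def using True by simp
  also have "\<dots> = (\<Sum>x\<le>d. of_nat (x choose k) * ((if x = 0 then 0 else Q (x - 1)) - Q x))
      + (\<Sum>x\<le>d. \<Sum>i\<in>I. if \<beta> i = 0 then 0 else of_nat (x choose k) * W i x)"
    unfolding c_eq distrib_left sum.distrib sum_distrib_left by (simp add: if_distrib cong: if_cong)
  also have "(\<Sum>x\<le>d. \<Sum>i\<in>I. if \<beta> i = 0 then 0 else of_nat (x choose k) * W i x) = mult_sum I (moment k t q) \<beta>"
    unfolding mult_sum_def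
  proof (subst sum.swap, rule sum.cong)
    fix i assume i: "i \<in> I"
    then have ij: "i < n" "i \<noteq> j" unfolding I_def by auto
    have "moment k t q (\<beta>(i := \<beta> i - 1)) = (\<Sum>x\<le>d. of_nat (x choose k) * W i x)" if "\<beta> i \<noteq> 0"
      using True ij that tdeg_upd[OF ij(1), of \<beta> "\<beta> i - 1"] unfolding moment_def W_def vars_def by auto
    then show "(\<Sum>x\<le>d. if \<beta> i = 0 then 0 else of_nat (x choose k) * W i x)
       = (if \<beta> i = 0 then 0 else moment k t q (\<beta>(i := \<beta> i - 1)))" by simp
  qed simp
  also have "(\<Sum>x\<le>d. of_nat (x choose k) * ((if x = 0 then 0 else Q (x - 1)) - Q x))
      = (if k = 0 then 0 else \<Sum>x\<le>d. of_nat (x choose (k - 1)) * Q x)"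
    unfolding sum_abel Qd by simp
  also have "\<dots> = (if k = 0 then 0 else moment (k - 1) (Suc t) q \<beta>)"
    unfolding moment_def Q_def using True by simp
  finally show ?thesis unfolding q_def by simp
qed

lemma moment_zero_row:
  assumes "R t = {}"
  shows "moment k t c \<beta> = 0"
proof -
  have "c (\<beta>(j := x)) = 0" if "vars n \<beta>" "\<beta> j = 0" "tdeg n \<beta> = t" for x
  proof (rule ccontr)
    assume "c (\<beta>(j := x)) \<noteq> 0"
    moreover have "rowdeg n j (\<beta>(j := x)) = t" unfolding rowdeg_upd[OF jn] using that by (simp add: rowdeg_def)
    ultimately show False using assms unfolding R_def mon_support_def by blast
  qed
  then show ?thesis unfolding moment_def by simp
qed

text \<open>Across an empty row, \<open>moment_Suc\<close> says that the k-th coefficient of q_(t+1)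
  is -\<sigma> times the (k + 1)-st coefficient of q_t. Each empty row thus contributes a factor
  \<sigma>.\<close>

lemma moment_gap:
  assumes "\<And>s. t < s \<Longrightarrow> s \<le> t + e \<Longrightarrow> R s = {}"
  shows "moment k (t + e) (quot n c) = (mult_sum I ^^ e) (\<lambda>\<beta>. (- 1) ^ e * moment (k + e) t (quot n c) \<beta>)"
  using assms
proof (induction e arbitrary: k)
  case (Suc e)
  have zero: "R (Suc (t + e)) = {}" using Suc.prems[of "Suc (t + e)"] by simp
  define h where "h = (\<lambda>\<beta>. (- 1) ^ e * moment (Suc k + e) t (quot n c) \<beta>)"
  have IH: "moment (Suc k) (t + e) (quot n c) = (mult_sum I ^^ e) h"
    using Suc.IH[of "Suc k"] Suc.prems unfolding h_def by simp
  have scale: "(mult_sum I ^^ m) (\<lambda>\<beta>. r * h \<beta>) = (\<lambda>\<beta>. r * (mult_sum I ^^ m) h \<beta>)" for m r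
    by (induction m) (simp_all add: mult_sum_scale)
  have "moment k (t + Suc e) (quot n c) \<beta> = - 1 * (mult_sum I ^^ Suc e) h \<beta>" for \<beta>
    using moment_Suc[of "Suc k" "t + e" \<beta>] moment_zero_row[OF zero, of "Suc k" \<beta>] IH by simp
  then have "moment k (t + Suc e) (quot n c) = (mult_sum I ^^ Suc e) (\<lambda>\<beta>. - 1 * h \<beta>)"
    unfolding scale by (rule ext)
  then show ?case unfolding h_def by simp
qed simp

section \<open>Counting monomials row by row\<close>

lemma finite_R: "finite (R t)" unfolding R_def using H_class_finite[OF cH] by simp

lemma moment_pos: "\<alpha> \<in> R t \<Longrightarrow> 0 < moment 0 t c (\<alpha>(j := 0))"
proof -
  assume \<alpha>: "\<alpha> \<in> R t"
  then have c\<alpha>: "c \<alpha> \<noteq> 0" "rowdeg n j \<alpha> = t" unfolding R_def mon_support_def by auto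
  have v: "vars n \<alpha>" and td: "tdeg n \<alpha> \<le> d" using H_class_support[OF cH c\<alpha>(1)] .
  have "\<alpha> j \<le> d" using le_tdeg[OF jn, of \<alpha>] td by simp
  have "tdeg n (\<alpha>(j := 0)) = t" using rowdeg_upd[OF jn, of \<alpha> 0] c\<alpha>(2) by (simp add: rowdeg_def)
  then have "moment 0 t c (\<alpha>(j := 0)) = (\<Sum>x\<le>d. c (\<alpha>(j := x)))"
    using v jn unfolding moment_def vars_def by auto
  moreover have "c (\<alpha>(j := \<alpha> j)) \<le> (\<Sum>x\<le>d. c (\<alpha>(j := x)))"
    using \<open>\<alpha> j \<le> d\<close> H_class_nonneg[OF cH] by (intro member_le_sum) auto
  moreover have "0 < c (\<alpha>(j := \<alpha> j))" using c\<alpha>(1) H_class_nonneg[OF cH, of \<alpha>] by simp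
  ultimately show ?thesis by simp
qed

lemma moment_support: "{\<beta>. moment 0 t c \<beta> \<noteq> 0} \<subseteq> (\<lambda>\<alpha>. \<alpha>(j := 0)) ` R t"
proof
  fix \<beta> assume "\<beta> \<in> {\<beta>. moment 0 t c \<beta> \<noteq> 0}"
  then have \<beta>: "\<beta> j = 0" "tdeg n \<beta> = t" "(\<Sum>x\<le>d. of_nat (x choose 0) * c (\<beta>(j := x))) \<noteq> 0"
    unfolding moment_def by (auto split: if_splits)
  obtain x where "c (\<beta>(j := x)) \<noteq> 0"
  proof (rule ccontr)
    assume "\<not> thesis"
    then have "c (\<beta>(j := x)) = 0" for x using that by blast
    then show False using \<beta>(3) by simp
  qed
  moreover have "rowdeg n j (\<beta>(j := x)) = t" unfolding rowdeg_upd[OF jn] using \<beta> by (simp add: rowdeg_def)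
  ultimately have "\<beta>(j := x) \<in> R t" unfolding R_def mon_support_def by simp
  moreover have "\<beta> = (\<beta>(j := x))(j := 0)" using \<beta>(1) by (simp add: fun_upd_idem)
  ultimately show "\<beta> \<in> (\<lambda>\<alpha>. \<alpha>(j := 0)) ` R t" by blast
qed

text \<open>At the j-th unit vector p equals 1, so a monomial in x_j alone, possibly constant, must
  occur.\<close>

lemma row_0: "R 0 \<noteq> {}"
proof -
  define x where "x i = (if i = j then 1 else 0 :: real)" for i
  have "(\<Sum>i<n. x i) = 1" unfolding x_def using jn by simp
  then have "peval n c x = 1" using cH unfolding H_class_def by blast
  then have "(\<Sum>\<alpha>\<in>mon_support c. c \<alpha> * (\<Prod>i<n. x i ^ \<alpha> i)) \<noteq> 0" unfolding peval_def by simp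
  then obtain \<alpha> where \<alpha>: "\<alpha> \<in> mon_support c" "c \<alpha> * (\<Prod>i<n. x i ^ \<alpha> i) \<noteq> 0"
    by (rule sum.not_neutral_contains_not_neutral)
  have "\<alpha> i = 0" if "i < n" "i \<noteq> j" for i
  proof (rule ccontr)
    assume "\<alpha> i \<noteq> 0"
    then have "x i ^ \<alpha> i = 0" using that unfolding x_def by simp
    then show False using \<alpha>(2) that(1) by auto
  qed
  then have "tdeg n (\<alpha>(j := 0)) = 0" unfolding tdeg_def by simp
  then have "rowdeg n j \<alpha> = 0" using rowdeg_upd[OF jn, of \<alpha> 0] by (simp add: rowdeg_def)
  then show ?thesis using \<alpha>(1) unfolding R_def by blast
qed

text \<open>At z = 1 the row is \<sigma>^J times a form: J - 1 factors come from the gap and one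
  from the row itself. It is nonzero by positivity, and setting z = 1 cannot increase the number of
  monomials.\<close>

lemma row_card:
  assumes n: "4 \<le> n" and J: "0 < J" and gap: "\<And>s. t < s \<Longrightarrow> s < t + J \<Longrightarrow> R s = {}" and ne: "R (t + J) \<noteq> {}"
  shows "(n - 1) * J \<le> card (R (t + J))"
proof -
  obtain e where e: "J = Suc e" using J by (cases J) auto
  define h where "h = (\<lambda>\<beta>. (- 1) ^ e * moment e t (quot n c) \<beta>)"
  have m: "moment 0 (t + J) c = (mult_sum I ^^ J) h"
  proof
    fix \<beta>
    have "moment 0 (t + e) (quot n c) = (mult_sum I ^^ e) h"
      using moment_gap[of t e 0] gap unfolding e h_def by simp
    then show "moment 0 (t + J) c \<beta> = (mult_sum I ^^ J) h \<beta>"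
      using moment_Suc[of 0 "t + e" \<beta>] unfolding e by simp
  qed
  define X where "X = {\<beta>. moment 0 (t + J) c \<beta> \<noteq> 0}"
  have finX: "finite X" unfolding X_def by (rule finite_surj[OF finite_R moment_support])
  have cardX: "card X \<le> card (R (t + J))"
    unfolding X_def using surj_card_le[OF finite_R moment_support] .
  obtain \<alpha> where "\<alpha> \<in> R (t + J)" using ne by blast
  then have "moment 0 (t + J) c (\<alpha>(j := 0)) \<noteq> 0" using moment_pos by fastforce
  moreover have "moment 0 (t + J) c = (\<lambda>_. 0)" if "\<And>\<beta>. h \<beta> = 0"
  proof -
    have "h = (\<lambda>_. 0)" using that by (rule ext)
    then show ?thesis unfolding m by (simp add: mult_sum_pow_zero)
  qed
  ultimately obtain \<beta>0 where "h \<beta>0 \<noteq> 0" by fastforce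
  have cI: "card I = n - 1" unfolding I_def using jn by simp
  have "card I * J \<le> card {\<beta>. ((mult_sum I ^^ J) h) \<beta> \<noteq> 0}"
  proof (rule mult_sum_card[of I h \<beta>0 J "t + J" "\<lambda>_. 0"])
    show "finite I" by (rule finite_I)
    show "3 \<le> card I" unfolding cI using n by simp
    show "h \<beta>0 \<noteq> 0" by fact
    show "finite {\<beta>. ((mult_sum I ^^ J) h) \<beta> \<noteq> 0}" using finX unfolding X_def m .
    fix \<beta> assume "((mult_sum I ^^ J) h) \<beta> \<noteq> 0"
    then have "moment 0 (t + J) c \<beta> \<noteq> 0" unfolding m .
    then have \<beta>: "vars n \<beta>" "\<beta> j = 0" "tdeg n \<beta> = t + J" unfolding moment_def by (auto split: if_splits)
    have "tdeg n \<beta> = \<beta> j + (\<Sum>i\<in>I. \<beta> i)" unfolding tdeg_def I_def using jn by (intro sum.remove) auto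
    then show "(\<Sum>i\<in>I. \<beta> i) = t + J \<and> (\<forall>i. i \<notin> I \<longrightarrow> \<beta> i = 0)"
      using \<beta> unfolding I_def vars_def by (auto simp: not_less)
  qed
  then show ?thesis using cardX unfolding cI X_def m by simp
qed

text \<open>Of two consecutive nonempty rows s < t the later one pays for the whole step with (n -
  1)(t - s) monomials; row 0 supplies the additional 1.\<close>

lemma many_variables_bound:
  assumes n: "4 \<le> n" and "R t \<noteq> {}"
  shows "(n - 1) * t + 1 \<le> card {\<alpha> \<in> mon_support c. rowdeg n j \<alpha> \<le> t}"
  using assms(2)
proof (induction t rule: less_induct)
  case (less t)
  have fin: "finite {\<alpha> \<in> mon_support c. rowdeg n j \<alpha> \<le> s}" for s using H_class_finite[OF cH] by simp
  show ?case
  proof (cases "t = 0")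
    case True
    have "{\<alpha> \<in> mon_support c. rowdeg n j \<alpha> \<le> t} \<noteq> {}" using less.prems unfolding R_def by auto
    then show ?thesis using fin[of t] True by (simp add: Suc_le_eq card_gt_0_iff)
  next
    case False
    define s where "s = Max {s. s < t \<and> R s \<noteq> {}}"
    have fins: "finite {s. s < t \<and> R s \<noteq> {}}" by simp
    have "0 \<in> {s. s < t \<and> R s \<noteq> {}}" using row_0 False by simp
    then have "{s. s < t \<and> R s \<noteq> {}} \<noteq> {}" by (metis empty_iff)
    from Max_in[OF fins this] have s: "s < t" "R s \<noteq> {}" unfolding s_def[symmetric] by simp_all
    have gap: "R r = {}" if r: "s < r" "r < t" for r
    proof (rule ccontr)
      assume "R r \<noteq> {}"
      then have "r \<le> s" using Max_ge[OF fins, of r] r(2) unfolding s_def by simp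
      then show False using r(1) by simp
    qed
    define J where "J = t - s"
    have J: "t = s + J" "0 < J" using s(1) unfolding J_def by auto
    have "(n - 1) * J \<le> card (R t)" using row_card[OF n J(2), of s] gap less.prems J(1) by simp
    moreover have "(n - 1) * s + 1 \<le> card {\<alpha> \<in> mon_support c. rowdeg n j \<alpha> \<le> s}"
      by (rule less.IH[OF s])
    moreover have "card {\<alpha> \<in> mon_support c. rowdeg n j \<alpha> \<le> s} + card (R t)
        \<le> card {\<alpha> \<in> mon_support c. rowdeg n j \<alpha> \<le> t}"
    proof -
      have "card {\<alpha> \<in> mon_support c. rowdeg n j \<alpha> \<le> s} + card (R t)
        = card ({\<alpha> \<in> mon_support c. rowdeg n j \<alpha> \<le> s} \<union> R t)"
        using fin[of s] finite_R s(1) by (intro card_Un_disjoint[symmetric]) (auto simp: R_def)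
      also have "\<dots> \<le> card {\<alpha> \<in> mon_support c. rowdeg n j \<alpha> \<le> t}"
        using fin[of t] s(1) by (intro card_mono) (auto simp: R_def)
      finally show ?thesis .
    qed
    moreover have "(n - 1) * t = (n - 1) * s + (n - 1) * J" unfolding J(1) by (simp add: distrib_left)
    ultimately show ?thesis by linarith
  qed
qed

end

section \<open>The degree estimate\<close>

text \<open>Setting x_a = u and x_b = 1 for the two variables other than x_j turns the rows into an
  instance of \<open>rows\<close>, with x_j as z.\<close>

lemma three_variables:
  assumes c: "c \<in> H_class 3 d" and j: "j < 3" and \<alpha>: "\<alpha>0 \<in> mon_support c"
    and max: "\<And>\<alpha>. \<alpha> \<in> mon_support c \<Longrightarrow> rowdeg 3 j \<alpha> \<le> rowdeg 3 j \<alpha>0" and pos: "1 \<le> rowdeg 3 j \<alpha>0"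
  shows "2 * rowdeg 3 j \<alpha>0 + 1 \<le> card (mon_support c)"
proof -
  define M where "M = rowdeg 3 j \<alpha>0"
  define a where "a = (if j = 0 then 1 else 0 :: nat)"
  define b where "b = (if j = 2 then 1 else 2 :: nat)"
  have ab: "a \<noteq> b" "a \<noteq> j" "b \<noteq> j" "{..<3} = {a, b, j}" "a < 3" "b < 3"
  proof -
    have "j = 0 \<or> j = 1 \<or> j = 2" using j by linarith
    moreover have "{..<3} = {0, 1, 2 :: nat}" by (auto simp: lessThan_def)
    ultimately show "a \<noteq> b" "a \<noteq> j" "b \<noteq> j" "{..<3} = {a, b, j}" "a < 3" "b < 3"
      unfolding a_def b_def by (elim disjE; simp add: insert_commute)+
  qed
  define vec where "vec x y z = (\<lambda>_ :: nat. 0 :: nat)(a := x, b := y, j := z)" for x y z :: nat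
  have vec: "vec x y z a = x" "vec x y z b = y" "vec x y z j = z"
    "(vec x y z)(a := x') = vec x' y z" "(vec x y z)(b := y') = vec x y' z" "(vec x y z)(j := z') = vec x y z'"
    for x y z x' y' z' using ab(1-3) unfolding vec_def by (auto simp: fun_eq_iff)
  have tdeg: "tdeg 3 (vec x y z) = x + y + z" for x y z
    unfolding tdeg_def ab(4) using ab(1-3) vec(1-3) by simp
  have rd: "rowdeg 3 j (vec x y z) = x + y" for x y z unfolding rowdeg_def tdeg vec by simp
  have vars: "vars 3 (vec x y z)" for x y z
    unfolding vars_def vec_def using ab(5,6) j by auto
  define q where "q = quot 3 c"
  have q0: "q (vec x y z) = 0" if "d \<le> x + y + z" for x y z
    unfolding q_def using quot_eq_0[OF c _ vars] that by (simp add: tdeg)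
  have c0: "c (vec x y z) = 0" if "d < x + y + z" for x y z
    using H_class_support(2)[OF c, of "vec x y z"] that by (force simp: tdeg)
  have rec: "c (vec x y z) = (if x = 0 \<and> y = 0 \<and> z = 0 then 1 else 0) - q (vec x y z)
    + (if x = 0 then 0 else q (vec (x - 1) y z)) + (if y = 0 then 0 else q (vec x (y - 1) z))
    + (if z = 0 then 0 else q (vec x y (z - 1)))" for x y z
  proof -
    have "vec x y z = (\<lambda>_. 0) \<longleftrightarrow> x = 0 \<and> y = 0 \<and> z = 0"
    proof
      assume "vec x y z = (\<lambda>_. 0)"
      then have "tdeg 3 (vec x y z) = 0" by (simp add: tdeg_def)
      then show "x = 0 \<and> y = 0 \<and> z = 0" unfolding tdeg by simp
    qed (auto simp: vec_def)
    moreover have "(\<Sum>i\<in>{..<3}. F i) = F a + F b + F j" for F :: "nat \<Rightarrow> real"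
      unfolding ab(4) using ab(1-3) by simp
    ultimately show ?thesis using quot_rec[of c "vec x y z" 3] unfolding mult_sum_def q_def[symmetric] by (simp only: vec)
  qed
  define P where "P t z = pol (\<lambda>x y. c (vec x y z)) t" for t z
  define G where "G t z = pol (\<lambda>x y. q (vec x y z)) t" for t z
  have PS: "P (Suc t) z = sg * G t z - shift_diff (G (Suc t)) z" for t z
  proof -
    define f' where "f' x y = c (vec x y z) + (q (vec x y z) - (if z = 0 then 0 else q (vec x y (z - 1))))" for x y
    have "pol f' (Suc t) = sg * pol (\<lambda>x y. q (vec x y z)) t"
    proof (rule pol_Suc)
      fix x y assume "x + y = Suc t"
      then show "f' x y = (if x = 0 then 0 else q (vec (x - 1) y z)) + (if y = 0 then 0 else q (vec x (y - 1) z))"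
        unfolding f'_def rec by auto
    qed
    moreover have "pol f' (Suc t) = P (Suc t) z + shift_diff (G (Suc t)) z"
      unfolding P_def G_def shift_diff_def
      by (rule poly_eqI) (simp add: coeff_pol f'_def)
    ultimately show ?thesis unfolding G_def by simp
  qed
  \<comment> \<open>Downwards from row M + d, where every total degree is at least d: rows of p
    beyond M are empty, so \<sigma> q_t = (1 - z) q_(t+1) = 0.\<close>
  have GM: "G t z = 0" if "M \<le> t" for t z
  proof -
    have "\<forall>z. G (M + (d - s)) z = 0" if "s \<le> d" for s
      using that
    proof (induction s)
      case 0
      show ?case unfolding G_def by (auto intro!: poly_eqI simp: coeff_pol q0)
    next
      case (Suc s)
      define t where "t = M + (d - Suc s)"
      have t: "Suc t = M + (d - s)" using Suc.prems unfolding t_def by simp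
      have "c (vec x y z) = 0" if "x + y = Suc t" for x y z
        using max[of "vec x y z"] that unfolding M_def[symmetric] t_def mon_support_def rd by auto
      then have "P (Suc t) z = 0" for z unfolding P_def by (auto intro!: poly_eqI simp: coeff_pol)
      moreover have "shift_diff (G (Suc t)) z = 0" for z
        using Suc.IH Suc.prems unfolding t shift_diff_def by simp
      ultimately have "G t z = 0" for z using PS[of t z] by simp
      then show ?case unfolding t_def by simp
    qed
    from this[of "M + d - t"] show ?thesis
    proof (cases "t \<le> M + d")
      case True
      then have "M + (d - (M + d - t)) = t" "M + d - t \<le> d" using that by auto
      then show ?thesis using \<open>M + d - t \<le> d \<Longrightarrow> \<forall>z. G (M + (d - (M + d - t))) z = 0\<close> by simp
    next
      case False
      then show ?thesis unfolding G_def by (auto intro!: poly_eqI simp: coeff_pol q0)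
    qed
  qed
  interpret rows P G M d
  proof
    show "1 \<le> M" using pos unfolding M_def .
    show "G t z = 0" if "d \<le> z" for t z unfolding G_def using that by (auto intro!: poly_eqI simp: coeff_pol q0)
    show "P t z = 0" if "d < z" for t z unfolding P_def using that by (auto intro!: poly_eqI simp: coeff_pol c0)
    show "0 \<le> coeff (P t z) i" for t z i unfolding P_def coeff_pol using H_class_nonneg[OF c] by simp
    show "P 0 z = (if z = 0 then 1 else 0) - shift_diff (G 0) z" for z
      unfolding P_def G_def shift_diff_def
      by (rule poly_eqI) (auto simp: coeff_pol rec[of 0 0])
    show "P (Suc t) z = sg * G t z - shift_diff (G (Suc t)) z" for t z by (rule PS)
    show "degree (G t z) \<le> t" for t z by (rule degree_le) (simp add: G_def coeff_pol)
    show "G M z = 0" for z by (rule GM) simp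
    have v0: "vars 3 \<alpha>0" using H_class_support(1)[OF c] \<alpha> unfolding mon_support_def by simp
    have "\<alpha>0 = vec (\<alpha>0 a) (\<alpha>0 b) (\<alpha>0 j)"
    proof
      fix i show "\<alpha>0 i = vec (\<alpha>0 a) (\<alpha>0 b) (\<alpha>0 j) i"
      proof (cases "i < 3")
        case True
        then have "i \<in> {a, b, j}" using ab(4) by auto
        then show ?thesis by (auto simp: vec)
      next
        case False
        then show ?thesis using v0 vars[of "\<alpha>0 a" "\<alpha>0 b" "\<alpha>0 j"] unfolding vars_def by simp
      qed
    qed
    then obtain x y z where xyz: "\<alpha>0 = vec x y z" by blast
    then have "x + y = M" unfolding M_def using rd by simp
    moreover have "c (vec x y z) \<noteq> 0" using \<alpha> xyz unfolding mon_support_def by simp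
    ultimately have "coeff (P M z) x \<noteq> 0" unfolding P_def coeff_pol by auto
    then show "\<exists>z. P M z \<noteq> 0" by (metis coeff_0)
  qed
  define Z where "Z = (SIGMA t:{..M}. SIGMA z:{..d}. {x. coeff (P t z) x \<noteq> 0})"
  have "(\<Sum>t\<le>M. T t) = card Z"
    unfolding Z_def T_def ncoef_def using finite_coeffs by (subst card_SigmaI) (auto simp: card_SigmaI)
  also have "\<dots> \<le> card (mon_support c)"
  proof (rule card_inj_on_le[of "\<lambda>(t, z, x). vec x (t - x) z"])
    show "inj_on (\<lambda>(t, z, x). vec x (t - x) z) Z"
    proof (rule inj_onI, clarify)
      fix t z x t' z' x'
      assume *: "(t, z, x) \<in> Z" "(t', z', x') \<in> Z" "vec x (t - x) z = vec x' (t' - x') z'"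
      have "x = x'" "t - x = t' - x'" "z = z'" using vec(1-3) *(3) by metis+
      moreover have "x \<le> t" "x' \<le> t'" using *(1,2) unfolding Z_def P_def coeff_pol by (auto split: if_splits)
      ultimately show "t = t' \<and> (z, x) = (z', x')" by simp
    qed
    show "(\<lambda>(t, z, x). vec x (t - x) z) ` Z \<subseteq> mon_support c"
      unfolding Z_def P_def coeff_pol mon_support_def by (auto split: if_splits)
    show "finite (mon_support c)" by (rule H_class_finite[OF c])
  qed
  finally show ?thesis using three_variable_bound unfolding M_def by simp
qed

lemma two_variables:
  assumes c: "c \<in> H_class 2 d" and d: "1 \<le> d"
  shows "d + 3 \<le> 2 * card (mon_support c)"
proof -
  define vec where "vec x y = (\<lambda>_ :: nat. 0 :: nat)(0 := x, 1 := y)" for x y :: nat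
  have vec: "vec x y 0 = x" "vec x y (Suc 0) = y" "(vec x y)(0 := x') = vec x' y" "(vec x y)(Suc 0 := y') = vec x y'"
    for x y x' y' unfolding vec_def by auto
  have tdeg: "tdeg 2 (vec x y) = x + y" for x y unfolding tdeg_def by (simp add: numeral_2_eq_2 vec)
  have vars: "vars 2 (vec x y)" for x y unfolding vars_def vec_def by auto
  define q where "q = quot 2 c"
  define p where "p = pol (\<lambda>x y. c (vec x y))"
  define g where "g = pol (\<lambda>x y. q (vec x y))"
  have rec: "p (Suc k) = sg * g k - g (Suc k)" for k
  proof -
    have "pol (\<lambda>x y. c (vec x y) + q (vec x y)) (Suc k) = sg * g k"
      unfolding g_def
    proof (rule pol_Suc)
      fix x y assume xy: "x + y = Suc k"
      have "vec x y \<noteq> (\<lambda>_. 0)"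
      proof
        assume "vec x y = (\<lambda>_. 0)"
        then have "tdeg 2 (vec x y) = 0" by (simp add: tdeg_def)
        then show False unfolding tdeg using xy by simp
      qed
      then show "c (vec x y) + q (vec x y) =
        (if x = 0 then 0 else q (vec (x - 1) y)) + (if y = 0 then 0 else q (vec x (y - 1)))"
        using quot_rec[of c "vec x y" 2] unfolding mult_sum_def q_def[symmetric]
        by (simp add: numeral_2_eq_2 vec)
    qed
    moreover have "pol (\<lambda>x y. c (vec x y) + q (vec x y)) (Suc k) = p (Suc k) + g (Suc k)"
      unfolding p_def g_def by (rule poly_eqI) (simp add: coeff_pol)
    ultimately show ?thesis by simp
  qed
  have "d + 3 \<le> 2 * (\<Sum>k\<in>{1..d}. ncoef (p k))"
  proof (rule two_variable_bound[where p = p and g = g, OF d rec])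
    show "0 \<le> coeff (p k) i" for k i unfolding p_def coeff_pol using H_class_nonneg[OF c] by simp
    have "q (vec x (d - x)) = 0" if "x \<le> d" for x
      unfolding q_def using quot_eq_0[OF c _ vars] that by (simp add: tdeg)
    then show "g d = 0" unfolding g_def by (auto intro!: poly_eqI simp: coeff_pol)
    obtain \<alpha> where \<alpha>: "\<alpha> \<in> level 2 d" "c \<alpha> \<noteq> 0" using H_class_top[OF c] by blast
    have "\<alpha> = vec (\<alpha> 0) (\<alpha> 1)"
    proof
      fix i show "\<alpha> i = vec (\<alpha> 0) (\<alpha> 1) i"
        using \<alpha>(1) unfolding level_def vars_def vec_def by (cases "i = 0"; cases "i = 1") auto
    qed
    then obtain x y where xy: "\<alpha> = vec x y" by blast
    then have "x + y = d" using \<alpha>(1) tdeg unfolding level_def by simp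
    then have "coeff (p d) x \<noteq> 0" unfolding p_def coeff_pol using \<alpha>(2) xy by auto
    then show "p d \<noteq> 0" by auto
  qed
  also have "(\<Sum>k\<in>{1..d}. ncoef (p k)) \<le> card (mon_support c)"
  proof -
    define Z where "Z = (SIGMA k:{1..d}. {x. coeff (p k) x \<noteq> 0})"
    have "(\<Sum>k\<in>{1..d}. ncoef (p k)) = card Z"
      unfolding Z_def ncoef_def using finite_coeffs by (subst card_SigmaI) auto
    also have "\<dots> \<le> card (mon_support c)"
    proof (rule card_inj_on_le[of "\<lambda>(k, x). vec x (k - x)"])
      show "inj_on (\<lambda>(k, x). vec x (k - x)) Z"
      proof (rule inj_onI, clarify)
        fix k x k' x'
        assume *: "(k, x) \<in> Z" "(k', x') \<in> Z" "vec x (k - x) = vec x' (k' - x')"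
        have "x = x'" "k - x = k' - x'" using vec(1,2) *(3) by metis+
        moreover have "x \<le> k" "x' \<le> k'" using *(1,2) unfolding Z_def p_def coeff_pol by (auto split: if_splits)
        ultimately show "k = k' \<and> x = x'" by simp
      qed
      show "(\<lambda>(k, x). vec x (k - x)) ` Z \<subseteq> mon_support c"
        unfolding Z_def p_def coeff_pol mon_support_def by (auto split: if_splits)
      show "finite (mon_support c)" by (rule H_class_finite[OF c])
    qed
    finally show ?thesis .
  qed
  finally show ?thesis by simp
qed

text \<open>The top homogeneous part is a multiple of the sum of the variables, so it has two distinct
  monomials; they cannot both be balanced.\<close>
lemma unbalanced_top_monomial:
  assumes c: "c \<in> H_class n d" and d: "1 \<le> d" and n: "2 \<le> n"
  shows "\<exists>\<alpha>\<in>mon_support c. \<exists>j<n. (n - 1) * d + 1 \<le> n * rowdeg n j \<alpha>"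
proof -
  \<comment> \<open>The part of q of degree d - 1. Since q vanishes in degree d, its product with s
    is the top part of p.\<close>
  define h where "h \<beta> = (if \<beta> \<in> level n (d - 1) then quot n c \<beta> else 0)" for \<beta>
  have h: "mult_sum {..<n} h \<alpha> = c \<alpha>" if \<alpha>: "\<alpha> \<in> level n d" for \<alpha>
  proof -
    have "vars n \<alpha>" "tdeg n \<alpha> = d" using \<alpha> unfolding level_def by auto
    then have "quot n c \<alpha> = 0" using quot_eq_0[OF c, of \<alpha>] n by simp
    moreover have "\<alpha> \<noteq> (\<lambda>_. 0)" using \<open>tdeg n \<alpha> = d\<close> d by (auto simp: tdeg_def)
    moreover have "mult_sum {..<n} h \<alpha> = mult_sum {..<n} (quot n c) \<alpha>"
      unfolding mult_sum_def
    proof (rule sum.cong)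
      fix i assume i: "i \<in> {..<n}"
      have "\<alpha>(i := \<alpha> i - 1) \<in> level n (d - 1)" if "\<alpha> i \<noteq> 0"
        using tdeg_upd[of i n \<alpha> "\<alpha> i - 1"] i that \<open>vars n \<alpha>\<close> \<open>tdeg n \<alpha> = d\<close> unfolding level_def vars_def by auto
      then show "(if \<alpha> i = 0 then 0 else h (\<alpha>(i := \<alpha> i - 1))) = (if \<alpha> i = 0 then 0 else quot n c (\<alpha>(i := \<alpha> i - 1)))"
        unfolding h_def by simp
    qed simp
    ultimately show ?thesis using quot_rec[of c \<alpha> n] by simp
  qed
  have lev: "\<alpha> \<in> level n d" if nz: "mult_sum {..<n} h \<alpha> \<noteq> 0" for \<alpha>
  proof -
    obtain i where i: "i \<in> {..<n}" "\<alpha> i \<noteq> 0" "h (\<alpha>(i := \<alpha> i - 1)) \<noteq> 0" using nz by (rule mult_sum_nonzero)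
    then have "\<alpha>(i := \<alpha> i - 1) \<in> level n (d - 1)" unfolding h_def by (auto split: if_splits)
    then show ?thesis using i d tdeg_upd[of i n \<alpha> "\<alpha> i - 1"] unfolding level_def vars_def by auto
  qed
  obtain \<alpha>0 where \<alpha>0: "\<alpha>0 \<in> level n d" "c \<alpha>0 \<noteq> 0" using H_class_top[OF c] by blast
  then have "mult_sum {..<n} h \<alpha>0 \<noteq> 0" using h by simp
  then obtain i where "h (\<alpha>0(i := \<alpha>0 i - 1)) \<noteq> 0" by (rule mult_sum_nonzero)
  \<comment> \<open>Even a single factor s forces an edge with two monomials.\<close>
  then have "\<exists>S\<subseteq>{\<beta>. ((mult_sum {..<n} ^^ 1) h) \<beta> \<noteq> 0}. edge 0 1 1 S"
    using n by (intro mult_sum_edge) auto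
  then obtain S where S: "S \<subseteq> {\<beta>. mult_sum {..<n} h \<beta> \<noteq> 0}" "edge 0 1 1 S" by auto
  then have "card S = 2" unfolding edge_def by simp
  then obtain \<alpha> \<beta> where ab: "\<alpha> \<in> S" "\<beta> \<in> S" "\<alpha> \<noteq> \<beta>" by (auto simp: card_2_iff)
  have lv: "\<gamma> \<in> level n d" "\<gamma> \<in> mon_support c" if "\<gamma> \<in> S" for \<gamma>
    using S(1) that lev[of \<gamma>] h[of \<gamma>] unfolding mon_support_def by auto
  \<comment> \<open>The exponents add up to d, so if none is below d / n, all are equal to
    it.\<close>
  have bal: "\<forall>j<n. n * \<gamma> j = d" if g: "\<gamma> \<in> S" and none: "\<forall>j<n. d \<le> n * \<gamma> j" for \<gamma>
  proof (rule ccontr)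
    assume "\<not> ?thesis"
    then obtain j where j: "j < n" "d < n * \<gamma> j" using none by (metis le_neq_implies_less)
    have "(\<Sum>i<n. d) < (\<Sum>i<n. n * \<gamma> i)" using j none by (intro sum_strict_mono_ex1) auto
    also have "\<dots> = n * d" using lv(1)[OF g] unfolding level_def tdeg_def by (simp add: sum_distrib_left[symmetric])
    finally show False by simp
  qed
  have "\<exists>\<gamma>\<in>S. \<exists>j<n. n * \<gamma> j < d"
  proof (rule ccontr)
    assume "\<not> ?thesis"
    then have none: "\<forall>j<n. d \<le> n * \<gamma> j" if "\<gamma> \<in> S" for \<gamma> using that by (meson not_less)
    have "\<alpha> = \<beta>"
    proof
      fix i
      show "\<alpha> i = \<beta> i"
      proof (cases "i < n")
        case True
        then have "n * \<alpha> i = n * \<beta> i" using bal[OF ab(1) none[OF ab(1)]] bal[OF ab(2) none[OF ab(2)]] by simp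
        then show ?thesis using n by simp
      next
        case False
        then show ?thesis using lv(1)[OF ab(1)] lv(1)[OF ab(2)] unfolding level_def vars_def by simp
      qed
    qed
    then show False using ab(3) by simp
  qed
  then obtain \<gamma> j where \<gamma>: "\<gamma> \<in> S" "j < n" "n * \<gamma> j < d" by blast
  have "rowdeg n j \<gamma> = d - \<gamma> j" using lv(1)[OF \<gamma>(1)] unfolding rowdeg_def level_def by simp
  then have "n * rowdeg n j \<gamma> = n * d - n * \<gamma> j" by (simp add: diff_mult_distrib2)
  moreover have "n * d = (n - 1) * d + d" using n by (cases n) auto
  ultimately have "(n - 1) * d + 1 \<le> n * rowdeg n j \<gamma>" using \<gamma>(3) by simp
  then show ?thesis using lv(2)[OF \<gamma>(1)] \<gamma>(2) by blast
qed

text \<open>The variable x_j comes from an unbalanced top monomial; M, the largest degree in the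
  other variables, is at least the row degree of that monomial.\<close>

lemma row_bound:
  assumes c: "c \<in> H_class n d" and d: "1 \<le> d" and n: "3 \<le> n"
  shows "\<exists>M. (n - 1) * d + 1 \<le> n * M \<and> (n - 1) * M + 1 \<le> Nmon c"
proof -
  obtain \<alpha> j where \<alpha>: "\<alpha> \<in> mon_support c" "j < n" "(n - 1) * d + 1 \<le> n * rowdeg n j \<alpha>"
    using unbalanced_top_monomial[OF c d] n by auto
  define M where "M = Max (rowdeg n j ` mon_support c)"
  have fin: "finite (mon_support c)" by (rule H_class_finite[OF c])
  have le: "rowdeg n j \<beta> \<le> M" if "\<beta> \<in> mon_support c" for \<beta>
    unfolding M_def using fin that by (intro Max_ge) auto
  have "M \<in> rowdeg n j ` mon_support c" unfolding M_def using fin \<alpha>(1) by (intro Max_in) auto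
  then obtain \<beta> where \<beta>: "\<beta> \<in> mon_support c" "M = rowdeg n j \<beta>" by blast
  have "n * rowdeg n j \<alpha> \<le> n * M" using le[OF \<alpha>(1)] by simp
  then have one: "(n - 1) * d + 1 \<le> n * M" using \<alpha>(3) by linarith
  then have M1: "1 \<le> M" by (cases M) auto
  have "(n - 1) * M + 1 \<le> Nmon c"
  proof (cases "n = 3")
    case True
    then show ?thesis
      using three_variables[of c d j \<beta>] c \<alpha>(2) \<beta> le M1 unfolding Nmon_def by simp
  next
    case False
    interpret hyperplane_polynomial n d j c using c \<alpha>(2) by unfold_locales
    have "R M \<noteq> {}" using \<beta> unfolding R_def by blast
    then have "(n - 1) * M + 1 \<le> card {\<alpha> \<in> mon_support c. rowdeg n j \<alpha> \<le> M}"
      using many_variables_bound[of M] n False by simp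
    also have "\<dots> \<le> Nmon c" unfolding Nmon_def using fin by (intro card_mono) auto
    finally show ?thesis .
  qed
  then show ?thesis using one by blast
qed

theorem theorem1:
  fixes n d :: nat and p :: "(nat \<Rightarrow> nat) \<Rightarrow> real"
  assumes "n \<ge> 2" and "d \<ge> 1" and "p \<in> H_class n d"
  shows "real d \<le> 2 * real n * (2 * real (Nmon p) - 3) / (3 * real n ^ 2 - 3 * real n - 2)
       \<and> 2 * real n * (2 * real (Nmon p) - 3) / (3 * real n ^ 2 - 3 * real n - 2)
           \<le> 4 / 3 * ((2 * real (Nmon p) - 3) / (2 * real n - 3))"
proof -
  define N where "N = 2 * real (Nmon p) - 3"
  define D where "D = 3 * real n ^ 2 - 3 * real n - 2"
  have n2: "2 \<le> real n" using assms(1) by simp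
  have "D = 3 * (real n - 2) * (real n + 1) + 4" unfolding D_def by (simp add: power2_eq_square algebra_simps)
  moreover have "0 \<le> 3 * (real n - 2) * (real n + 1)" using n2 by simp
  ultimately have D: "0 < D" by linarith
  have main: "real d * D \<le> 2 * real n * N"
  proof (cases "n = 2")
    case True
    then have "d + 3 \<le> 2 * Nmon p" using two_variables[of p d] assms unfolding Nmon_def by simp
    then have "real d \<le> N" unfolding N_def by linarith
    moreover have "D = 4" unfolding D_def True by simp
    ultimately show ?thesis using True by simp
  next
    case False
    then have n3: "3 \<le> n" using assms(1) by simp
    obtain M where M: "(n - 1) * d + 1 \<le> n * M" "(n - 1) * M + 1 \<le> Nmon p"
      using row_bound[OF assms(3,2) n3] by blast
    have r: "real (n - 1) = real n - 1" using assms(1) by simp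
    have M1: "(real n - 1) * real d + 1 \<le> real n * real M"
      using M(1) r by (metis (mono_tags) of_nat_1 of_nat_add of_nat_le_iff of_nat_mult)
    have M2: "(real n - 1) * real M + 1 \<le> real (Nmon p)"
      using M(2) r by (metis (mono_tags) of_nat_1 of_nat_add of_nat_le_iff of_nat_mult)
    have "4 * (real n - 1) * ((real n - 1) * real d + 1) \<le> 4 * (real n - 1) * (real n * real M)"
      using M1 n2 by (intro mult_left_mono) auto
    also have "\<dots> = 4 * real n * ((real n - 1) * real M)" by simp
    also have "\<dots> \<le> 4 * real n * (real (Nmon p) - 1)" using M2 by (intro mult_left_mono) auto
    finally have upper: "4 * (real n - 1) * ((real n - 1) * real d + 1) - 2 * real n \<le> 2 * real n * N"
      unfolding N_def by (simp add: algebra_simps)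
    \<comment> \<open>The slack left after eliminating M from the two estimates; both summands are
      nonnegative for n \<ge> 3.\<close>
    define X where "X = (real n - 2) * (real n - 3) * real d + 2 * (real n - 2)"
    have "0 \<le> X" unfolding X_def using n3 by simp
    moreover have "4 * (real n - 1) * ((real n - 1) * real d + 1) - 2 * real n = real d * D + X"
      unfolding D_def X_def by (simp add: power2_eq_square algebra_simps)
    ultimately show ?thesis using upper by simp
  qed
  then have first: "real d \<le> 2 * real n * N / D" using D by (simp add: pos_le_divide_eq)
  have "0 < real d * D" using assms(2) D by simp
  \<comment> \<open>The second inequality needs N > 0, which follows from the first one because d
    \<ge> 1.\<close>
  then have "0 < 2 * real n * N" using main by linarith
  then have N: "0 < N" using n2 by (simp add: zero_less_mult_iff)
  have "2 * real n * N / D \<le> 4 / 3 * (N / (2 * real n - 3))"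
  proof -
    \<comment> \<open>The difference of the two sides is 6 n - 8.\<close>
    have "2 * real n * (3 * (2 * real n - 3)) \<le> 4 * D"
      unfolding D_def using n2 by (simp add: power2_eq_square algebra_simps)
    then have "N * (2 * real n * (3 * (2 * real n - 3))) \<le> N * (4 * D)" using N by (intro mult_left_mono) auto
    moreover have "0 < 3 * (2 * real n - 3)" using n2 by simp
    ultimately have "2 * real n * N / D \<le> 4 * N / (3 * (2 * real n - 3))"
      using D by (subst frac_le_eq) (auto intro!: divide_nonpos_pos simp: algebra_simps)
    then show ?thesis by simp
  qed
  then show ?thesis using first unfolding N_def D_def by blast
qed

end
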